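(* Let $x=(x_1,\ldots,x_n)$, $f=(f_1,\ldots,f_s)\in\mathbb{Q}[x]^s$ and $g\in\mathbb{Q}[x]$ be such that: (1) for all $z\in V(f)\subset\mathbb{C}^n$, the Jacobian matrix $Jf(z)$ of $f$ has rank $s\le n$; (2) $V(f)\cap\mathbb{R}^n$ is bounded; (3) $g$ has finitely many critical points on $V(f)$. Let $$L(x,\lambda)=\{f_1,\ldots,f_s\}\cup\left\{\frac{\partial g}{\partial x_i}+\sum_{j=1}^s\lambda_j\frac{\partial f_j}{\partial x_i}\;:\;i=1,\ldots,n\right\}\subset\mathbb{Q}[x_1,\ldots,x_n,\lambda_1,\ldots,\lambda_s],$$ let $J$ be the ideal generated by $L$ in $\mathbb{Q}[x,\lambda]$, and let $\mathcal{B}\subset\mathbb{Q}[x,\lambda]$ be any finite monomial basis for $\mathbb{Q}[x,\lambda]/J$. Then $$\sigma(H_g^{\mathcal{B}})=\sigma(H_{g^2}^{\mathcal{B}})\quad\text{if and only if}\quad g(x)\ge0\ \text{ for all }x\in V(f)\cap\mathbb{R}^n,$$ where $H_g^{\mathcal{B}}$ and $H_{g^2}^{\mathcal{B}}$ are the Hermite matrices of $J$ with respect to $g$ and $g^2$ in the basis $\mathcal{B}$.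
   Context: $V(f)\subset\mathbb{C}^n$ is the set of common complex zeros of $f_1,\ldots,f_s$. Critical point: $z\in\mathbb{C}^n$ is a critical point of $g$ in $V(f)$ if $z\in V(f)$, $z$ is non-singular in $V(f)$, i.e. the Jacobian matrix $Jf(z)$ has rank $c:=n-\dim V(f)$, and the matrix $Jf(z)$ augmented with the row vector $\nabla g(z)$ also has rank $c$. (This notion is defined for $\langle f_1,\ldots,f_s\rangle$ radical.) Hermite matrix: for a zero-dimensional ideal $J$ in a polynomial ring $R$ over $\mathbb{Q}$, with monomial basis $\mathcal{B}=\{b_1,\ldots,b_k\}$ of $A=R/J$, and $h\in R$, $H_h^{\mathcal{B}}=H_h^{\mathcal{B}}(J):=[\mathrm{Tr}(\mu_{h\,b_ib_j})]_{i,j=1}^k$, where $\mu_p:A\to A$ is multiplication by $p$; this is a rational symmetric matrix. Signature: for a real symmetric matrix $A$, $\sigma(A)$ is the number of positive eigenvalues minus the number of negative eigenvalues (counted with multiplicity). *)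

theory Defs
  imports
    "HOL-Analysis.Analysis"
    "HOL-Library.Poly_Mapping"
    "HOL-Algebra.QuotRing"
    "Jordan_Normal_Form.Char_Poly"
    "Jordan_Normal_Form.VS_Connect"
begin

section \<open>Multivariate polynomials\<close>

text \<open>The polynomial ring over \<open>'a\<close> in variables indexed by the finite type \<open>'v\<close> is the monoid
  algebra of the exponent vectors, with the ring operations of \<^theory>\<open>HOL-Library.Poly_Mapping\<close>.\<close>

type_synonym ('v, 'a) mpoly = "('v \<Rightarrow>\<^sub>0 nat) \<Rightarrow>\<^sub>0 'a"

definition monomial :: "('v \<Rightarrow>\<^sub>0 nat) \<Rightarrow> ('v, 'a::comm_semiring_1) mpoly" where
  "monomial m = Poly_Mapping.single m 1"

definition Var :: "'v \<Rightarrow> ('v, 'a::comm_semiring_1) mpoly" where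
  "Var i = monomial (Poly_Mapping.single i 1)"

definition Const :: "'a \<Rightarrow> ('v, 'a::comm_semiring_1) mpoly" where
  "Const c = Poly_Mapping.single 0 c"

text \<open>Evaluation at \<open>z\<close>, with the coefficients mapped along \<open>\<phi>\<close>.  The target may itself be
  a polynomial ring, so that this is also substitution.\<close>

definition mp_eval ::
    "('a::zero \<Rightarrow> 'b::comm_semiring_1) \<Rightarrow> ('v::finite \<Rightarrow> 'b) \<Rightarrow> ('v, 'a) mpoly \<Rightarrow> 'b" where
  "mp_eval \<phi> z p = (\<Sum>m\<in>Poly_Mapping.keys p.
     \<phi> (Poly_Mapping.lookup p m) * (\<Prod>i\<in>UNIV. z i ^ Poly_Mapping.lookup m i))"

text \<open>The subtraction of exponents truncates only where the coefficient is \<open>0\<close> anyway.\<close>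

definition pderivative :: "'v \<Rightarrow> ('v, 'a::comm_semiring_1) mpoly \<Rightarrow> ('v, 'a) mpoly" where
  "pderivative i p = (\<Sum>m\<in>Poly_Mapping.keys p.
     Poly_Mapping.single (m - Poly_Mapping.single i 1)
       (of_nat (Poly_Mapping.lookup m i) * Poly_Mapping.lookup p m))"


section \<open>Varieties, dimension and critical points\<close>

definition variety :: "('s \<Rightarrow> ('n::finite, rat) mpoly) \<Rightarrow> (complex^'n) set" where
  "variety f = {z. \<forall>j. mp_eval of_rat (vec_nth z) (f j) = 0}"

definition real_points :: "(complex^'n) set \<Rightarrow> (real^'n) set" where
  "real_points V = {x. (\<chi> i. complex_of_real (vec_nth x i)) \<in> V}"

definition zariski_closed :: "(complex^'n::finite) set \<Rightarrow> bool" where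
  "zariski_closed Z \<longleftrightarrow>
     (\<exists>P :: ('n, complex) mpoly set. Z = {z. \<forall>p\<in>P. mp_eval id (vec_nth z) p = 0})"

definition irreducible_closed :: "(complex^'n::finite) set \<Rightarrow> bool" where
  "irreducible_closed Z \<longleftrightarrow> zariski_closed Z \<and> Z \<noteq> {} \<and>
     (\<forall>A B. zariski_closed A \<and> zariski_closed B \<and> Z = A \<union> B \<longrightarrow> Z = A \<or> Z = B)"

text \<open>Krull dimension: the largest \<open>d\<close> for which there is a chain
  \<open>Z 0 \<subset> Z 1 \<subset> \<dots> \<subset> Z d\<close> of irreducible closed subsets of \<open>V\<close>.  These lengths are bounded by
  \<open>CARD('n)\<close>, so the supremum is a maximum; the value for the empty set is \<open>0\<close> by
  convention.\<close>

definition variety_dim :: "(complex^'n::finite) set \<Rightarrow> nat" where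
  "variety_dim V = Sup {d. \<exists>Z :: nat \<Rightarrow> (complex^'n) set.
     (\<forall>i\<le>d. irreducible_closed (Z i) \<and> Z i \<subseteq> V) \<and> (\<forall>i<d. Z i \<subset> Z (Suc i))}"

definition jacobian_at :: "('s::finite \<Rightarrow> ('n::finite, rat) mpoly) \<Rightarrow> complex^'n \<Rightarrow> complex^'n^'s" where
  "jacobian_at f z = (\<chi> j i. mp_eval of_rat (vec_nth z) (pderivative i (f j)))"

text \<open>The additional row, the gradient of \<open>g\<close>, has index \<^const>\<open>None\<close>.\<close>

definition augmented_jacobian_at ::
    "('s::finite \<Rightarrow> ('n::finite, rat) mpoly) \<Rightarrow> ('n, rat) mpoly \<Rightarrow> complex^'n \<Rightarrow> complex^'n^('s option)"
  where "augmented_jacobian_at f g z =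
     (\<chi> k i. mp_eval of_rat (vec_nth z) (pderivative i (case k of Some j \<Rightarrow> f j | None \<Rightarrow> g)))"

definition critical_point ::
    "('s::finite \<Rightarrow> ('n::finite, rat) mpoly) \<Rightarrow> ('n, rat) mpoly \<Rightarrow> complex^'n \<Rightarrow> bool" where
  "critical_point f g z \<longleftrightarrow>
     (let c = CARD('n) - variety_dim (variety f) in
        z \<in> variety f \<and> rank (jacobian_at f z) = c \<and> rank (augmented_jacobian_at f g z) = c)"


section \<open>The ideal of the Lagrange system\<close>

text \<open>In the ring with variables \<open>'n + 's\<close> the variable \<open>x\<^sub>i\<close> is \<open>Var (Inl i)\<close> and the
  multiplier \<open>\<lambda>\<^sub>j\<close> is \<open>Var (Inr j)\<close>.\<close>

definition lift_x :: "('n::finite, rat) mpoly \<Rightarrow> ('n + 's, rat) mpoly" where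
  "lift_x p = mp_eval Const (\<lambda>i. Var (Inl i)) p"

definition lagrange_system ::
    "('s::finite \<Rightarrow> ('n::finite, rat) mpoly) \<Rightarrow> ('n, rat) mpoly \<Rightarrow> ('n + 's, rat) mpoly set" where
  "lagrange_system f g =
     {lift_x (f j) | j. True} \<union>
     {lift_x (pderivative i g) + (\<Sum>j\<in>UNIV. Var (Inr j) * lift_x (pderivative i (f j))) | i. True}"

definition lagrange_ideal ::
    "('s::finite \<Rightarrow> ('n::finite, rat) mpoly) \<Rightarrow> ('n, rat) mpoly \<Rightarrow> ('n + 's, rat) mpoly set" where
  "lagrange_ideal f g = Idl\<^bsub>class_ring\<^esub> (lagrange_system f g)"


section \<open>Quotient algebras, traces and Hermite matrices\<close>

text \<open>The quotient ring of a polynomial ring over \<open>'k\<close> by \<open>J\<close>, extended by the scalar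
  multiplication of \<open>'k\<close>.\<close>

definition quotient_algebra ::
    "('v, 'k::field) mpoly set \<Rightarrow> ('k, ('v, 'k) mpoly set) module" where
  "quotient_algebra J = ring.extend (class_ring Quot J)
     (module.fields (\<lambda>c X. (J +>\<^bsub>class_ring\<^esub> Const c) \<otimes>\<^bsub>class_ring Quot J\<^esub> X))"

lemma quotient_algebra_vectorspace:
  fixes J :: "('v, 'k::field) mpoly set"
  assumes "ideal J class_ring"
  shows "vectorspace class_ring (quotient_algebra J)"
proof -
  let ?R = "class_ring :: ('v, 'k) mpoly ring" and ?V = "quotient_algebra J"
  let ?h = "\<lambda>p. J +>\<^bsub>?R\<^esub> p"
  interpret J: ideal J ?R by (rule assms)
  interpret Q: cring "?R Quot J"
    by (rule J.quotient_is_cring) unfold_locales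
  note hom = J.rcos_ring_hom
  have simps: "carrier ?V = carrier (?R Quot J)" "add ?V = add (?R Quot J)"
    "zero ?V = zero (?R Quot J)"
    "module.smult ?V = (\<lambda>c X. ?h (Const c) \<otimes>\<^bsub>?R Quot J\<^esub> X)"
    by (simp_all add: quotient_algebra_def ring.defs module.defs)
  have closed: "?h p \<in> carrier (?R Quot J)" for p
    using ring_hom_closed[OF hom, of p] by simp
  have h_add: "?h (p + q) = ?h p \<oplus>\<^bsub>?R Quot J\<^esub> ?h q" for p q
    using ring_hom_add[OF hom, of p q] by simp
  have h_mult: "?h (p * q) = ?h p \<otimes>\<^bsub>?R Quot J\<^esub> ?h q" for p q
    using ring_hom_mult[OF hom, of p q] by simp
  have h_one: "?h 1 = \<one>\<^bsub>?R Quot J\<^esub>"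
    using ring_hom_one[OF hom] by simp
  have Const: "Const (a + b) = Const a + (Const b :: ('v, 'k) mpoly)"
    "Const (a * b) = Const a * (Const b :: ('v, 'k) mpoly)"
    "Const 1 = (1 :: ('v, 'k) mpoly)" for a b
    by (simp_all add: Const_def single_add mult_single)
  have "abelian_group ?V"
  proof (rule abelian_groupI, unfold simps)
    fix x assume "x \<in> carrier (?R Quot J)"
    then show "\<exists>y\<in>carrier (?R Quot J). y \<oplus>\<^bsub>?R Quot J\<^esub> x = \<zero>\<^bsub>?R Quot J\<^esub>"
      using Q.l_neg Q.a_inv_closed by blast
  qed (simp_all add: Q.a_ac)
  moreover have "cring (class_ring :: 'k ring)" by unfold_locales
  ultimately have "Module.module (class_ring :: 'k ring) ?V"
    by (intro Module.module.intro module_axioms.intro)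
      (simp_all add: simps closed Const h_add h_mult h_one Q.l_distr Q.r_distr Q.m_assoc)
  then show ?thesis
    by (intro vectorspace.intro class_field)
qed

definition coordinates ::
    "('k::field, 'b, 'm) module_scheme \<Rightarrow> 'b set \<Rightarrow> 'b \<Rightarrow> 'b \<Rightarrow> 'k" where
  "coordinates V B v =
     (THE a. a \<in> B \<rightarrow>\<^sub>E UNIV \<and> LinearCombinations.module.lincomb V a B = v)"

text \<open>The trace of an endomorphism of a finite-dimensional space: the sum of the diagonal entries
  of its matrix with respect to some basis (the choice is immaterial).\<close>

definition lin_trace :: "('k::field, 'b, 'm) module_scheme \<Rightarrow> ('b \<Rightarrow> 'b) \<Rightarrow> 'k" where
  "lin_trace V T =
     (let B = (SOME B. finite B \<and> vectorspace.basis class_ring V B)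
      in \<Sum>b\<in>B. coordinates V B (T b) b)"

definition mult_map ::
    "('v, 'k::field) mpoly set \<Rightarrow> ('v, 'k) mpoly \<Rightarrow> ('v, 'k) mpoly set \<Rightarrow> ('v, 'k) mpoly set" where
  "mult_map J p X = (J +>\<^bsub>class_ring\<^esub> p) \<otimes>\<^bsub>quotient_algebra J\<^esub> X"

text \<open>A monomial basis is given as a list of exponent vectors; its order fixes the order of the
  rows and columns of the Hermite matrix.\<close>

definition monomial_basis :: "('v, 'k::field) mpoly set \<Rightarrow> ('v \<Rightarrow>\<^sub>0 nat) list \<Rightarrow> bool" where
  "monomial_basis J bs \<longleftrightarrow>
     (let cs = map (\<lambda>m. J +>\<^bsub>class_ring\<^esub> monomial m) bs
      in distinct cs \<and> vectorspace.basis class_ring (quotient_algebra J) (set cs))"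

definition hermite_matrix ::
    "('v, 'k::field) mpoly set \<Rightarrow> ('v \<Rightarrow>\<^sub>0 nat) list \<Rightarrow> ('v, 'k) mpoly \<Rightarrow> 'k mat" where
  "hermite_matrix J bs h =
     Matrix.mat (length bs) (length bs)
       (\<lambda>(i, j). lin_trace (quotient_algebra J)
          (mult_map J (h * monomial (bs ! i) * monomial (bs ! j))))"

text \<open>The algebraic multiplicity used here is the geometric one for a symmetric matrix.\<close>

definition signature :: "real mat \<Rightarrow> int" where
  "signature A =
     int (\<Sum>x | eigenvalue A x \<and> x > 0. Polynomial.order x (char_poly A)) -
     int (\<Sum>x | eigenvalue A x \<and> x < 0. Polynomial.order x (char_poly A))"

end

theory Submission
  imports Defs "Jordan_Normal_Form.Schur_Decomposition"
begin

text \<open>The trace of multiplication by \<open>p\<close> on \<open>\<rat>[x, \<lambda>]/J\<close> is the sum of the values of \<open>p\<close> at the finitely many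
  complex zeros of \<open>J\<close>, weighted by positive multiplicities. Hence the quadratic form of the Hermite
  matrix of \<open>h\<close> is \<open>v \<mapsto> \<Sum>\<^sub>z m(z) h(z) v(z)\<^sup>2\<close>. A pair of conjugate nonreal zeros contributes signature 0 and a
  real zero \<open>z\<close> contributes the sign of \<open>h(z)\<close>, so the signatures for \<open>g\<close> and \<open>g\<^sup>2\<close> agree if and only if
  \<open>g\<close> is nonnegative at all real zeros of \<open>J\<close>. If the compact set \<open>V(f) \<inter> \<real>\<^sup>n\<close> is nonempty, \<open>g\<close> attains its
  minimum there, and by the Lagrange multiplier rule the minimizer lifts to a real zero of \<open>J\<close>.\<close>

unbundle no vec_syntax
no_notation inner (infix "\<bullet>" 70)


section \<open>Inertia and signature of real symmetric matrices\<close>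

text \<open>The positive multiplicities are found without localization. Multiplication by
  \<open>p\<close> has as eigenvalues exactly the values of \<open>p\<close> at the complex zeros,
  because ring homomorphisms from the quotient to the complex numbers are evaluations at zeros. An
  element with value 1 at one zero and 0 at the others thus acts with eigenvalues 0 and 1 only; its
  trace is the multiplicity of that zero, a natural number that is positive because 1 does occur.
  There may be fewer zeros than elements of the basis, so the Hermite form can be degenerate and the
  evaluations need not be a system of coordinates. The law of inertia is therefore stated for
  linearly independent forms, and interpolation at the zeros supplies the independence. As the form
  is taken on real vectors, interpolation with real coefficients is needed, for values compatible
  with conjugation. Equality of the two signatures can be tested zero by zero because the sign of a
  real number never exceeds the sign of its square.\<close>

lemma underdetermined_system:
  fixes a :: "'e \<Rightarrow> 'u \<Rightarrow> 'a::field"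
  assumes "finite E" "finite U" "card E < card U"
  shows "\<exists>t. (\<exists>u\<in>U. t u \<noteq> 0) \<and> (\<forall>e\<in>E. (\<Sum>u\<in>U. a e u * t u) = 0)"
  using assms
proof (induction E arbitrary: U a rule: finite_induct)
  case empty
  then obtain u where "u \<in> U" by fastforce
  then show ?case by (intro exI[of _ "\<lambda>_. 1"]) auto
next
  case (insert e E)
  show ?case
  proof (cases "\<forall>u\<in>U. a e u = 0")
    case True
    have "card E < card U" using insert by simp
    from insert.IH[OF insert.prems(1) this, of a] obtain t where
      "\<exists>u\<in>U. t u \<noteq> 0" "\<forall>e\<in>E. (\<Sum>u\<in>U. a e u * t u) = 0" by blast
    then show ?thesis using True by (intro exI[of _ t]) auto
  next
    case False
    then obtain w where w: "w \<in> U" "a e w \<noteq> 0" by blast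
    let ?U = "U - {w}"
    \<comment> \<open>Gaussian elimination of the unknown \<open>w\<close> by means of equation
      \<open>e\<close>; the value of \<open>s\<close> at \<open>w\<close> below is the back
      substitution.\<close>
    let ?b = "\<lambda>e' u. a e' u - a e' w * a e u / a e w"
    have "card E < card ?U" using insert w by (simp add: card_Diff_singleton)
    from insert.IH[OF _ this, of ?b] insert.prems(1) obtain t where
      t: "\<exists>u\<in>?U. t u \<noteq> 0" "\<forall>e'\<in>E. (\<Sum>u\<in>?U. ?b e' u * t u) = 0" by auto
    define s where "s = (\<lambda>u. if u = w then - (\<Sum>u\<in>?U. a e u * t u) / a e w else t u)"
    have split: "(\<Sum>u\<in>U. a e' u * s u) = a e' w * s w + (\<Sum>u\<in>?U. a e' u * t u)" for e'
      using w(1) insert.prems(1) by (simp add: sum.remove s_def cong: sum.cong_simp)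
    have "(\<Sum>u\<in>U. a e u * s u) = 0"
      using w(2) unfolding split by (simp add: s_def)
    moreover have "(\<Sum>u\<in>U. a e' u * s u) = 0" if "e' \<in> E" for e'
    proof -
      have "0 = (\<Sum>u\<in>?U. a e' u * t u) - (\<Sum>u\<in>?U. a e' w / a e w * (a e u * t u))"
        using t(2) that by (simp add: left_diff_distrib sum_subtractf mult.assoc)
      also have "\<dots> = (\<Sum>u\<in>U. a e' u * s u)"
        unfolding split by (simp add: s_def sum_distrib_left[symmetric] sum_divide_distrib[symmetric])
      finally show ?thesis by simp
    qed
    moreover have "\<exists>u\<in>U. s u \<noteq> 0" using t(1) by (auto simp: s_def)
    ultimately show ?thesis by blast
  qed
qed

text \<open>If there were more positive \<open>c i\<close> than positive \<open>d j\<close>, then some nonzero vector in the span of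
  preimages of the corresponding unit vectors would be annihilated by all \<open>Y j\<close> with \<open>d j > 0\<close>.\<close>

lemma inertia_le:
  fixes l :: "'i \<Rightarrow> nat \<Rightarrow> real" and y :: "'j \<Rightarrow> nat \<Rightarrow> real"
    and k :: nat
  defines "L \<equiv> \<lambda>i v. \<Sum>m<k. l i m * v m" and "Y \<equiv> \<lambda>j v. \<Sum>m<k. y j m * v m"
  assumes fin: "finite I" "finite J"
    and eq: "\<And>v. (\<Sum>i\<in>I. c i * (L i v)\<^sup>2) = (\<Sum>j\<in>J. d j * (Y j v)\<^sup>2)"
    and surj: "\<And>t. \<exists>v. \<forall>i\<in>I. L i v = t i"
  shows "card {i\<in>I. c i > 0} \<le> card {j\<in>J. d j > 0}"
proof (rule ccontr)
  let ?I = "{i\<in>I. c i > 0}" and ?J = "{j\<in>J. d j > 0}"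
  assume "\<not> ?thesis"
  then have less: "card ?J < card ?I" by simp
  have "\<exists>v. \<forall>i'\<in>I. L i' v = (if i' = i then 1 else 0)" for i by (rule surj)
  then obtain e where e: "\<And>i i'. i' \<in> I \<Longrightarrow> L i' (e i) = (if i' = i then 1 else 0)" by metis
  from underdetermined_system[OF _ _ less, of "\<lambda>j i. Y j (e i)"] fin obtain t where
    t: "\<exists>i\<in>?I. t i \<noteq> 0" "\<forall>j\<in>?J. (\<Sum>i\<in>?I. Y j (e i) * t i) = 0" by auto
  define v where "v = (\<lambda>m. \<Sum>i\<in>?I. t i * e i m)"
  have lin: "(\<Sum>m<k. w m * v m) = (\<Sum>i\<in>?I. (\<Sum>m<k. w m * e i m) * t i)" for w :: "nat \<Rightarrow> real"
  proof -
    have "(\<Sum>m<k. w m * v m) = (\<Sum>m<k. \<Sum>i\<in>?I. w m * e i m * t i)"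
      by (simp add: v_def sum_distrib_left mult_ac)
    also have "\<dots> = (\<Sum>i\<in>?I. \<Sum>m<k. w m * e i m * t i)" by (rule sum.swap)
    finally show ?thesis by (simp add: sum_distrib_right)
  qed
  have Lv: "L i v = (if i \<in> ?I then t i else 0)" if "i \<in> I" for i
  proof -
    have "L i v = (\<Sum>i'\<in>?I. L i (e i') * t i')" unfolding L_def by (rule lin)
    also have "\<dots> = (\<Sum>i'\<in>?I. if i = i' then t i' else 0)"
      using that by (intro sum.cong) (auto simp: e)
    finally show ?thesis using fin by simp
  qed
  have Yv: "Y j v = 0" if "j \<in> ?J" for j
    using t(2) that unfolding Y_def lin by simp
  obtain i0 where i0: "i0 \<in> ?I" "t i0 \<noteq> 0" using t(1) by blast
  \<comment> \<open>At \<open>v\<close> the left-hand form is positive, because every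
    \<open>L i v\<close> with \<open>c i \<le> 0\<close> vanishes; the right-hand form is at most 0,
    because every \<open>Y j v\<close> with \<open>d j > 0\<close> vanishes.\<close>
  have "0 < c i0 * (L i0 v)\<^sup>2" using i0 by (simp add: Lv)
  also have "\<dots> \<le> (\<Sum>i\<in>I. c i * (L i v)\<^sup>2)"
    using i0 fin by (intro member_le_sum) (auto simp: Lv not_less)
  also have "\<dots> \<le> 0"
    unfolding eq by (rule sum_nonpos) (metis (mono_tags, lifting) Yv linorder_not_le mem_Collect_eq
      mult_nonpos_nonneg order_refl power_zero_numeral mult_zero_right zero_le_power2)
  finally show False by simp
qed

text \<open>Sylvester's law of inertia. \<open>inertia_le\<close> used in both directions matches
  the positive coefficients, and applied to the negated forms it matches the negative ones. The
  surjectivity assumptions express linear independence of the forms, so the index sets may have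
  fewer than \<open>k\<close> elements.\<close>

corollary inertia_sgn:
  fixes l :: "'i \<Rightarrow> nat \<Rightarrow> real" and y :: "'j \<Rightarrow> nat \<Rightarrow> real"
  assumes fin: "finite I" "finite J"
    and eq: "\<And>v. (\<Sum>i\<in>I. c i * (\<Sum>m<k. l i m * v m)\<^sup>2) = (\<Sum>j\<in>J. d j * (\<Sum>m<k. y j m * v m)\<^sup>2)"
    and surj: "\<And>t. \<exists>v. \<forall>i\<in>I. (\<Sum>m<k. l i m * v m) = t i"
      "\<And>t. \<exists>v. \<forall>j\<in>J. (\<Sum>m<k. y j m * v m) = t j"
  shows "(\<Sum>i\<in>I. sgn (c i)) = (\<Sum>j\<in>J. sgn (d j))"
proof -
  have sgn_card: "(\<Sum>x\<in>A. sgn (f x)) = real (card {x\<in>A. f x > 0}) - real (card {x\<in>A. - f x > 0})"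
    if "finite A" for A and f :: "'x \<Rightarrow> real"
  proof -
    have "(\<Sum>x\<in>A. sgn (f x)) = (\<Sum>x\<in>A. (if f x > 0 then 1 else 0) - (if - f x > 0 then 1 else 0))"
      by (rule sum.cong) (auto simp: sgn_if)
    then show ?thesis using that by (simp add: sum_subtractf sum.If_cases Int_def)
  qed
  have eq': "(\<Sum>i\<in>I. - c i * (\<Sum>m<k. l i m * v m)\<^sup>2) = (\<Sum>j\<in>J. - d j * (\<Sum>m<k. y j m * v m)\<^sup>2)" for v
    using eq[of v] by (simp add: sum_negf)
  have "card {i\<in>I. c i > 0} = card {j\<in>J. d j > 0}" "card {i\<in>I. - c i > 0} = card {j\<in>J. - d j > 0}"
    using inertia_le[OF fin eq surj(1)] inertia_le[OF fin(2,1) eq[symmetric] surj(2)]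
    inertia_le[OF fin eq' surj(1)] inertia_le[OF fin(2,1) eq'[symmetric] surj(2)] by (simp_all add: le_antisym)
  then show ?thesis by (simp add: sgn_card fin)
qed

section \<open>Orthogonal diagonalization of real symmetric matrices\<close>

text \<open>The characteristic polynomial has a complex root; symmetry makes it real, and then the
  real and imaginary parts of a complex eigenvector satisfy the eigenvalue equation separately. One
  of them is nonzero and can be normalized.\<close>

lemma real_symmetric_eigenvector:
  fixes A :: "real mat"
  assumes A: "A \<in> carrier_mat n n" and sym: "transpose_mat A = A" and n: "n > 0"
  shows "\<exists>e v. v \<in> carrier_vec n \<and> v \<bullet> v = 1 \<and> A *\<^sub>v v = e \<cdot>\<^sub>v v"
proof -
  have symD: "A $$ (i, j) = A $$ (j, i)" if "i < n" "j < n" for i j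
    using A that sym by (metis carrier_matD(1,2) index_transpose_mat(1))
  define Ac where "Ac = map_mat complex_of_real A"
  have Ac: "Ac \<in> carrier_mat n n" using A by (simp add: Ac_def)
  obtain as where as: "char_poly Ac = (\<Prod>a\<leftarrow>as. [:- a, 1:])" "length as = n"
    using char_poly_factorized[OF Ac] by blast
  then have "poly (char_poly Ac) (hd as) = 0" using n by (cases as) auto
  then have "eigenvalue Ac (hd as)" using eigenvalue_root_char_poly[OF Ac] by simp
  then obtain w where w: "w \<in> carrier_vec n" "w \<noteq> 0\<^sub>v n" "Ac *\<^sub>v w = hd as \<cdot>\<^sub>v w"
    using Ac unfolding eigenvalue_def eigenvector_def by auto
  define e where "e = hd as"
  have ew: "(\<Sum>j<n. complex_of_real (A $$ (i, j)) * w $ j) = e * w $ i" if "i < n" for i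
  proof -
    have "(Ac *\<^sub>v w) $ i = (\<Sum>j<n. complex_of_real (A $$ (i, j)) * w $ j)"
      using that A w(1) by (simp add: Ac_def scalar_prod_def lessThan_atLeast0)
    then show ?thesis using that w by (simp add: e_def)
  qed
  obtain i0 where i0: "i0 < n" "w $ i0 \<noteq> 0" using w(1,2) by (metis carrier_vecD eq_vecI index_zero_vec(1,2))
  define N where "N = (\<Sum>i<n. (cmod (w $ i))\<^sup>2)"
  have "N > 0" unfolding N_def using i0 by (intro sum_pos2[of _ i0]) auto
  \<comment> \<open>Both sides are the Hermitian form of \<open>A\<close> at \<open>w\<close>, which
    equals its own conjugate because \<open>A\<close> is real and symmetric. As \<open>N\<close> is
    a positive real, \<open>e\<close> is real.\<close>
  have "e * of_real N = (\<Sum>i<n. cnj (w $ i) * (e * w $ i))"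
    by (simp add: N_def sum_distrib_left complex_norm_square mult_ac del: of_real_power)
  also have "\<dots> = (\<Sum>i<n. \<Sum>j<n. of_real (A $$ (i, j)) * (cnj (w $ i) * w $ j))"
    by (intro sum.cong) (simp_all add: ew[symmetric] sum_distrib_left mult_ac)
  also have "\<dots> = (\<Sum>j<n. \<Sum>i<n. of_real (A $$ (i, j)) * (cnj (w $ i) * w $ j))"
    by (rule sum.swap)
  also have "\<dots> = cnj (\<Sum>j<n. \<Sum>i<n. of_real (A $$ (j, i)) * (cnj (w $ j) * w $ i))"
    by (auto intro!: sum.cong simp: symD mult_ac)
  also have "\<dots> = cnj (\<Sum>j<n. cnj (w $ j) * (e * w $ j))"
    by (intro arg_cong[of _ _ cnj] sum.cong) (simp_all add: ew[symmetric] sum_distrib_left mult_ac)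
  also have "\<dots> = cnj (e * of_real N)"
    by (simp add: N_def sum_distrib_left complex_norm_square mult_ac del: of_real_power)
  finally have "e = cnj e" using \<open>N > 0\<close> by simp
  then have e: "e = of_real (Re e)" by (simp add: complex_eq_iff)
  have re: "(\<Sum>j<n. A $$ (i, j) * Re (w $ j)) = Re e * Re (w $ i)"
    and im: "(\<Sum>j<n. A $$ (i, j) * Im (w $ j)) = Re e * Im (w $ i)" if "i < n" for i
    using arg_cong[OF ew[OF that], of Re] arg_cong[OF ew[OF that], of Im] e
    by (simp_all add: complex_eq_iff)
  \<comment> \<open>Whichever part of \<open>w\<close> is nonzero at the coordinate
    \<open>i0\<close>.\<close>
  define u where "u = (if Re (w $ i0) \<noteq> 0 then Matrix.vec n (\<lambda>i. Re (w $ i)) else Matrix.vec n (\<lambda>i. Im (w $ i)))"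
  have u: "u \<in> carrier_vec n" by (simp add: u_def)
  have u0: "u $ i0 \<noteq> 0" using i0 by (auto simp: u_def complex_eq_iff)
  have eu: "(\<Sum>j<n. A $$ (i, j) * u $ j) = Re e * u $ i" if "i < n" for i
    using that re im by (simp add: u_def)
  define c where "c = (\<Sum>i<n. (u $ i)\<^sup>2)"
  have "c > 0" unfolding c_def using i0 u0 by (intro sum_pos2[of _ i0]) auto
  define v where "v = (1 / sqrt c) \<cdot>\<^sub>v u"
  have "v \<bullet> v = (\<Sum>i<n. (u $ i)\<^sup>2 / c)"
    using u \<open>c > 0\<close> by (auto simp: v_def scalar_prod_def lessThan_atLeast0 power2_eq_square intro!: sum.cong)
  also have "\<dots> = 1" using \<open>c > 0\<close> by (simp add: c_def sum_divide_distrib[symmetric])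
  finally have "v \<bullet> v = 1" .
  moreover have "A *\<^sub>v v = Re e \<cdot>\<^sub>v v"
  proof (rule eq_vecI)
    fix i assume "i < dim_vec (Re e \<cdot>\<^sub>v v)"
    then have i: "i < n" using u by (simp add: v_def)
    have "(A *\<^sub>v v) $ i = (\<Sum>j<n. A $$ (i, j) * u $ j) / sqrt c"
      using i A u by (simp add: v_def scalar_prod_def lessThan_atLeast0 sum_divide_distrib)
    then show "(A *\<^sub>v v) $ i = (Re e \<cdot>\<^sub>v v) $ i" using i u by (simp add: eu v_def)
  qed (use A u in \<open>simp add: v_def\<close>)
  moreover have "v \<in> carrier_vec n" using u by (simp add: v_def)
  ultimately show ?thesis by blast
qed

text \<open>The reflection in the hyperplane orthogonal to \<open>w = v - e_0\<close> exchanges the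
  unit vectors \<open>e_0\<close> and \<open>v\<close>. It completes \<open>v\<close> to an
  orthogonal matrix that is its own inverse and its own transpose. For \<open>v = e_0\<close> the
  vector \<open>w\<close> is zero and the identity serves instead.\<close>

lemma householder_reflection:
  fixes v :: "real vec"
  assumes v: "v \<in> carrier_vec n" "v \<bullet> v = 1" and n: "n > 0"
  shows "\<exists>H \<in> carrier_mat n n. transpose_mat H = H \<and> H * H = 1\<^sub>m n \<and> col H 0 = v"
proof (cases "v = unit_vec n 0")
  case True
  then show ?thesis using n by (intro bexI[of _ "1\<^sub>m n"]) auto
next
  case False
  define w where "w = (\<lambda>i. v $ i - (if i = 0 then 1 else 0))"
  have vv: "(\<Sum>i<n. v $ i * v $ i) = 1"
    using v by (simp add: scalar_prod_def lessThan_atLeast0)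
  define s where "s = (\<Sum>i<n. w i * w i)"
  have "s = (\<Sum>i<n. v $ i * v $ i - (if i = 0 then 2 * v $ 0 - 1 else 0))"
    unfolding s_def by (intro sum.cong) (auto simp: w_def algebra_simps)
  then have s: "s = 2 - 2 * v $ 0" using n by (simp add: sum_subtractf vv)
  have "s \<noteq> 0"
  proof
    assume "s = 0"
    then have "\<forall>i\<in>{..<n}. w i * w i = 0" unfolding s_def by (subst (asm) sum_nonneg_eq_0_iff) auto
    then have "v = unit_vec n 0" using v by (intro eq_vecI) (auto simp: w_def unit_vec_def)
    then show False using False by simp
  qed
  define h where "h = (\<lambda>i j. (if i = j then 1 else 0) - 2 / s * w i * w j)"
  define H where "H = Matrix.mat n n (\<lambda>(i, j). h i j)"
  have H: "H \<in> carrier_mat n n" by (simp add: H_def)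
  have "transpose_mat H = H" by (rule eq_matI) (auto simp: H_def h_def)
  moreover have "H * H = 1\<^sub>m n"
  proof (rule eq_matI)
    fix i j assume "i < dim_row (1\<^sub>m n :: real mat)" "j < dim_col (1\<^sub>m n :: real mat)"
    then have ij: "i < n" "j < n" by auto
    have "(H * H) $$ (i, j) = (\<Sum>k<n. h i k * h k j)"
      using ij by (simp add: H_def scalar_prod_def lessThan_atLeast0)
    also have "\<dots> = (\<Sum>k<n. (if k = i then (if i = j then 1 else 0) - 2 / s * w i * w j else 0)
       - (if k = j then 2 / s * w i * w j else 0) + 4 / (s * s) * w i * w j * (w k * w k))"
      by (intro sum.cong) (auto simp: h_def algebra_simps)
    also have "\<dots> = (if i = j then 1 else 0) - 2 / s * w i * w j - 2 / s * w i * w j + 4 / (s * s) * w i * w j * s"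
      using ij by (simp add: sum.distrib sum_subtractf s_def sum_distrib_left)
    also have "\<dots> = (if i = j then 1 else 0)" using \<open>s \<noteq> 0\<close> by (simp add: field_simps)
    finally show "(H * H) $$ (i, j) = 1\<^sub>m n $$ (i, j)" using ij by simp
  qed (auto simp: H_def)
  moreover have "col H 0 = v"
  proof (rule eq_vecI)
    fix i assume "i < dim_vec v"
    then have i: "i < n" using v by simp
    \<comment> \<open>Because \<open>v\<close> has length 1, \<open>w 0\<close> is
      \<open>- s / 2\<close>, so the correction in column 0 is exactly \<open>+ w\<close> and turns
      \<open>e_0\<close> into \<open>v\<close>.\<close>
    have "2 * w 0 = - s" using s by (simp add: w_def)
    moreover have "2 / s * w i * w 0 = w i / s * (2 * w 0)" by simp
    ultimately have "2 / s * w i * w 0 = - w i" using \<open>s \<noteq> 0\<close> by simp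
    then have "h i 0 = (if i = 0 then 1 else 0) + w i" by (simp add: h_def)
    then show "col H 0 $ i = v $ i" using i n by (auto simp: H_def w_def)
  qed (use v in \<open>simp add: H_def\<close>)
  ultimately show ?thesis using H by blast
qed

text \<open>Conjugation with the reflection that moves \<open>e_0\<close> to a unit eigenvector
  splits off a 1 by 1 block; the induction hypothesis diagonalizes the remaining block.\<close>

lemma real_symmetric_diagonalization:
  fixes A :: "real mat"
  assumes "A \<in> carrier_mat n n" "transpose_mat A = A"
  shows "\<exists>P D. P \<in> carrier_mat n n \<and> D \<in> carrier_mat n n \<and> diagonal_mat D \<and>
    P * transpose_mat P = 1\<^sub>m n \<and> transpose_mat P * P = 1\<^sub>m n \<and> A = P * D * transpose_mat P"
  using assms
proof (induction n arbitrary: A)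
  case 0
  then show ?case by (intro exI[of _ A]) (auto simp: diagonal_mat_def)
next
  case (Suc n)
  let ?n = "Suc n"
  note A = Suc.prems(1)
  obtain e v where v: "v \<in> carrier_vec ?n" "v \<bullet> v = 1" "A *\<^sub>v v = e \<cdot>\<^sub>v v"
    using real_symmetric_eigenvector[OF Suc.prems] by auto
  obtain H where H: "H \<in> carrier_mat ?n ?n" "transpose_mat H = H" "H * H = 1\<^sub>m ?n" "col H 0 = v"
    using householder_reflection[OF v(1,2)] by auto
  define B where "B = H * A * H"
  have B: "B \<in> carrier_mat ?n ?n" using A H by (simp add: B_def)
  have symB: "transpose_mat B = B"
    using A H Suc.prems(2) unfolding B_def
    by (simp add: transpose_mult[of _ ?n ?n _ ?n] assoc_mult_mat[of _ ?n ?n _ ?n _ ?n])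
  \<comment> \<open>\<open>H\<close> takes \<open>e_0\<close> to \<open>v\<close>, \<open>A\<close>
    scales \<open>v\<close> by \<open>e\<close>, and \<open>H\<close> takes \<open>v\<close> back to
    \<open>e_0\<close>. By symmetry the first row of \<open>B\<close> is then cleared as
    well.\<close>
  have "col B 0 = e \<cdot>\<^sub>v unit_vec ?n 0"
  proof -
    have "col B 0 = col (H * (A * H)) 0"
      using A H unfolding B_def by (simp add: assoc_mult_mat[of _ ?n ?n _ ?n _ ?n])
    also have "\<dots> = H *\<^sub>v col (A * H) 0" using A H by (intro col_mult2[of _ ?n ?n _ ?n]) auto
    also have "col (A * H) 0 = A *\<^sub>v v" using A H by (subst col_mult2[of _ ?n ?n _ ?n]) auto
    also have "H *\<^sub>v (A *\<^sub>v v) = H *\<^sub>v (e \<cdot>\<^sub>v v)" by (simp add: v(3))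
    also have "\<dots> = e \<cdot>\<^sub>v (H *\<^sub>v col H 0)"
      using H v by (simp add: mult_mat_vec[of _ ?n ?n])
    also have "H *\<^sub>v col H 0 = col (H * H) 0" using H(1) by (intro col_mult2[symmetric]) auto
    finally show ?thesis using H by simp
  qed
  then have Bi0: "B $$ (i, 0) = (if i = 0 then e else 0)" if "i < ?n" for i
    using that B by (metis (no_types) carrier_matD index_col index_smult_vec(1) index_unit_vec
        mult.right_neutral mult_zero_right zero_less_Suc index_unit_vec(3))
  have symBD: "B $$ (i, j) = B $$ (j, i)" if "i < ?n" "j < ?n" for i j
    using B that symB by (metis carrier_matD(1,2) index_transpose_mat(1))
  define C where "C = Matrix.mat n n (\<lambda>(i, j). B $$ (Suc i, Suc j))"
  have C: "C \<in> carrier_mat n n" by (simp add: C_def)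
  have "transpose_mat C = C" by (rule eq_matI) (auto simp: C_def symBD)
  from Suc.IH[OF C this] obtain Q D where Q: "Q \<in> carrier_mat n n" and D: "D \<in> carrier_mat n n"
    and QD: "diagonal_mat D" "Q * transpose_mat Q = 1\<^sub>m n" "transpose_mat Q * Q = 1\<^sub>m n"
      "C = Q * D * transpose_mat Q" by blast
  let ?e = "Matrix.mat 1 1 (\<lambda>_. e)" and ?z = "0\<^sub>m 1 n :: real mat" and ?z' = "0\<^sub>m n 1 :: real mat"
  define R where "R = four_block_mat (1\<^sub>m 1) ?z ?z' Q"
  define E where "E = four_block_mat ?e ?z ?z' D"
  have R: "R \<in> carrier_mat ?n ?n" and E: "E \<in> carrier_mat ?n ?n"
    using Q D by (auto simp: R_def E_def)
  have tR: "transpose_mat R = four_block_mat (1\<^sub>m 1) ?z ?z' (transpose_mat Q)"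
    using Q unfolding R_def by (subst transpose_four_block_mat[of _ 1 1 _ n _ n]) auto
  have tQ: "transpose_mat Q \<in> carrier_mat n n" using Q by simp
  note block = mult_four_block_mat[of _ 1 1 _ n _ n _ _ 1 _ n]
  have RR: "R * transpose_mat R = 1\<^sub>m ?n" "transpose_mat R * R = 1\<^sub>m ?n"
    using Q QD unfolding tR unfolding R_def by (subst block; simp)+
  have "R * E * transpose_mat R = four_block_mat ?e ?z ?z' C"
    unfolding tR using Q D QD(4) unfolding R_def E_def
    by (subst block; simp)+
  also have "\<dots> = B"
  proof (rule eq_matI)
    fix i j assume "i < dim_row B" "j < dim_col B"
    then show "four_block_mat ?e ?z ?z' C $$ (i, j) = B $$ (i, j)"
      using B C Bi0 symBD[of 0 j] by (cases i; cases j) (auto simp: C_def)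
  qed (use B C in auto)
  finally have B_eq: "B = R * E * transpose_mat R" ..
  note assoc = assoc_mult_mat[of _ ?n ?n _ ?n _ ?n]
  have "A = H * B * H"
    using A H unfolding B_def by (simp add: assoc) (simp add: H assoc[symmetric])
  define P where "P = H * R"
  have P: "P \<in> carrier_mat ?n ?n" using H R by (simp add: P_def)
  have tP: "transpose_mat P = transpose_mat R * H"
    using H R by (simp add: P_def transpose_mult[of _ ?n ?n _ ?n])
  have "P * transpose_mat P = H * (R * transpose_mat R) * H"
    using H R unfolding P_def tP[unfolded P_def] by (simp add: assoc)
  moreover have "transpose_mat P * P = transpose_mat R * (H * H) * R"
    using H(1) R unfolding P_def tP[unfolded P_def] by (simp add: assoc)
  moreover have "A = P * E * transpose_mat P"
    using \<open>A = H * B * H\<close> H R E unfolding B_eq P_def tP[unfolded P_def] by (simp add: assoc)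
  moreover have "diagonal_mat E"
    using D QD(1) unfolding diagonal_mat_def E_def by auto
  ultimately show ?case using H R RR P E by (intro exI[of _ P] exI[of _ E]) auto
qed

section \<open>The signature computed from a sum of squares\<close>

lemma order_prod_linear_factors:
  "Polynomial.order x (\<Prod>a\<leftarrow>as. [:- a, 1:]) = count_list as (x :: 'a::idom)"
proof (induction as)
  case (Cons a as)
  have "Polynomial.order x [:- a, 1:] = (if a = x then 1 else 0)"
    using order_power_n_n[of a 1] by (auto intro: order_0I)
  moreover have "[:- a, 1:] * (\<Prod>a\<leftarrow>as. [:- a, 1:]) \<noteq> 0"
    unfolding mult_eq_0_iff by (auto simp: prod_list_zero_iff)
  ultimately show ?case using Cons.IH by (simp add: order_mult del: mult_pCons_left)
qed simp

lemma signature_eq_sum_sgn: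
  assumes A: "A \<in> carrier_mat n n" and cp: "char_poly A = (\<Prod>a\<leftarrow>as. [:- a, 1:])"
  shows "real_of_int (signature A) = (\<Sum>a\<leftarrow>as. sgn a)"
proof -
  have ev: "eigenvalue A x \<longleftrightarrow> x \<in> set as" for x
    using eigenvalue_root_char_poly[OF A] unfolding cp by (auto simp: poly_prod_list prod_list_zero_iff)
  have count: "(\<Sum>x | eigenvalue A x \<and> P x. Polynomial.order x (char_poly A)) = length (filter P as)" for P
  proof -
    have "length (filter P as) = (\<Sum>x\<in>set (filter P as). count_list (filter P as) x)"
      by (intro sum_count_set[symmetric]) auto
    also have "\<dots> = (\<Sum>x | eigenvalue A x \<and> P x. Polynomial.order x (char_poly A))"
    proof (rule sum.cong)
      fix x assume "x \<in> {x. eigenvalue A x \<and> P x}"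
      then show "count_list (filter P as) x = Polynomial.order x (char_poly A)"
        unfolding cp order_prod_linear_factors by (induction as) auto
    qed (auto simp: ev)
    finally show ?thesis ..
  qed
  have "real (length (filter (\<lambda>x. x > 0) as)) - real (length (filter (\<lambda>x. x < 0) as)) = (\<Sum>a\<leftarrow>as. sgn a)"
    by (induction as) auto
  then show ?thesis by (simp add: signature_def count)
qed

text \<open>An orthogonal diagonalization writes the quadratic form of \<open>A\<close> as a sum of
  squares with the eigenvalues as coefficients, and the law of inertia compares this sum with the
  given one. Since \<open>I\<close> may be smaller than \<open>k\<close>, degenerate matrices are
  included.\<close>

lemma signature_eq_of_square_sum:
  fixes A :: "real mat" and l :: "'i \<Rightarrow> nat \<Rightarrow> real"
  assumes A: "A \<in> carrier_mat k k" "transpose_mat A = A" and fin: "finite I"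
    and eq: "\<And>v. (\<Sum>i\<in>I. c i * (\<Sum>m<k. l i m * v m)\<^sup>2) = (\<Sum>i<k. \<Sum>j<k. A $$ (i, j) * v i * v j)"
    and surj: "\<And>t. \<exists>v. \<forall>i\<in>I. (\<Sum>m<k. l i m * v m) = t i"
  shows "real_of_int (signature A) = (\<Sum>i\<in>I. sgn (c i))"
proof -
  obtain P D where P: "P \<in> carrier_mat k k" and D: "D \<in> carrier_mat k k" "diagonal_mat D"
    and PP: "P * transpose_mat P = 1\<^sub>m k" "transpose_mat P * P = 1\<^sub>m k"
    and APD: "A = P * D * transpose_mat P"
    using real_symmetric_diagonalization[OF A] by blast
  \<comment> \<open>Similarity preserves the characteristic polynomial, so the diagonal of
    \<open>D\<close> lists the eigenvalues of \<open>A\<close> with their algebraic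
    multiplicities.\<close>
  have "similar_mat A D" using A P D PP APD by (intro similar_matI[of _ _ P "transpose_mat P" k]) auto
  moreover have "upper_triangular D" using D by (auto simp: upper_triangular_def diagonal_mat_def)
  ultimately have "char_poly A = (\<Prod>a\<leftarrow>diag_mat D. [:- a, 1:])"
    using char_poly_similar char_poly_upper_triangular[OF D(1)] by metis
  from signature_eq_sum_sgn[OF A(1) this]
  have sig: "real_of_int (signature A) = (\<Sum>j<k. sgn (D $$ (j, j)))"
    using D by (simp add: diag_mat_def interv_sum_list_conv_sum_set_nat lessThan_atLeast0)
  have A_index: "A $$ (i, m) = (\<Sum>j<k. D $$ (j, j) * (P $$ (i, j) * P $$ (m, j)))" if "i < k" "m < k" for i m
  proof -
    have PD: "(P * D) $$ (i, j) = P $$ (i, j) * D $$ (j, j)" if "j < k" for j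
    proof -
      have "(P * D) $$ (i, j) = (\<Sum>j'<k. P $$ (i, j') * D $$ (j', j))"
        using P D \<open>i < k\<close> that by (simp add: scalar_prod_def lessThan_atLeast0)
      also have "\<dots> = (\<Sum>j'<k. if j' = j then P $$ (i, j) * D $$ (j, j) else 0)"
        using D that by (intro sum.cong) (auto simp: diagonal_mat_def)
      finally show ?thesis using that by simp
    qed
    have "(E * transpose_mat P) $$ (i, m) = (\<Sum>j<k. E $$ (i, j) * P $$ (m, j))"
      if "E \<in> carrier_mat k k" for E
      using that P \<open>i < k\<close> \<open>m < k\<close> by (simp add: scalar_prod_def lessThan_atLeast0)
    from this[of "P * D"] have "A $$ (i, m) = (\<Sum>j<k. (P * D) $$ (i, j) * P $$ (m, j))"
      using P D unfolding APD by (meson mult_carrier_mat)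
    then show ?thesis by (simp add: PD mult_ac)
  qed
  have eq': "(\<Sum>j<k. D $$ (j, j) * (\<Sum>m<k. P $$ (m, j) * v m)\<^sup>2)
      = (\<Sum>i<k. \<Sum>j<k. A $$ (i, j) * v i * v j)" for v
  proof -
    have "(\<Sum>j<k. D $$ (j, j) * (\<Sum>m<k. P $$ (m, j) * v m)\<^sup>2)
      = (\<Sum>j<k. \<Sum>i<k. \<Sum>m<k. D $$ (j, j) * (P $$ (i, j) * P $$ (m, j)) * v i * v m)"
      by (simp add: power2_eq_square sum_product sum_distrib_left mult_ac)
    also have "\<dots> = (\<Sum>i<k. \<Sum>j<k. \<Sum>m<k. D $$ (j, j) * (P $$ (i, j) * P $$ (m, j)) * v i * v m)"
      by (rule sum.swap)
    also have "\<dots> = (\<Sum>i<k. \<Sum>m<k. \<Sum>j<k. D $$ (j, j) * (P $$ (i, j) * P $$ (m, j)) * v i * v m)"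
      by (intro sum.cong sum.swap refl)
    also have "\<dots> = (\<Sum>i<k. \<Sum>m<k. A $$ (i, m) * v i * v m)"
      by (intro sum.cong refl)
        (simp add: A_index sum_distrib_right)
    finally show ?thesis .
  qed
  have surj': "\<exists>v. \<forall>j\<in>{..<k}. (\<Sum>m<k. P $$ (m, j) * v m) = t j" for t
  proof -
    \<comment> \<open>The columns of \<open>P\<close> are orthonormal, so \<open>v = P t\<close>
      solves the transposed system.\<close>
    define v where "v = (\<lambda>m. \<Sum>j<k. P $$ (m, j) * t j)"
    have "(\<Sum>m<k. P $$ (m, j) * v m) = t j" if "j < k" for j
    proof -
      have "(\<Sum>m<k. P $$ (m, j) * v m) = (\<Sum>m<k. \<Sum>j'<k. P $$ (m, j) * P $$ (m, j') * t j')"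
        by (simp add: v_def sum_distrib_left mult_ac)
      also have "\<dots> = (\<Sum>j'<k. \<Sum>m<k. P $$ (m, j) * P $$ (m, j') * t j')" by (rule sum.swap)
      also have "\<dots> = (\<Sum>j'<k. (transpose_mat P * P) $$ (j, j') * t j')"
        using P that by (intro sum.cong) (auto simp: scalar_prod_def lessThan_atLeast0 sum_distrib_right)
      also have "\<dots> = (\<Sum>j'<k. if j = j' then t j' else 0)"
        using that by (intro sum.cong) (auto simp: PP(2))
      finally show ?thesis using that by simp
    qed
    then show ?thesis by blast
  qed
  show ?thesis unfolding sig
    by (rule inertia_sgn[where k = k and y = l and l = "\<lambda>j m. P $$ (m, j)"]) (use fin eq eq' surj surj' in auto)
qed

section \<open>The trace as the sum of the eigenvalues\<close>

definition mat_trace :: "'a::comm_monoid_add mat \<Rightarrow> 'a" where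
  "mat_trace A = (\<Sum>i<dim_row A. A $$ (i, i))"

lemma mat_trace_mult_comm:
  fixes A :: "'a::comm_semiring_0 mat"
  assumes "A \<in> carrier_mat n n" "B \<in> carrier_mat n n"
  shows "mat_trace (A * B) = mat_trace (B * A)"
proof -
  have "mat_trace (A * B) = (\<Sum>i<n. \<Sum>j<n. A $$ (i, j) * B $$ (j, i))"
    using assms by (simp add: mat_trace_def scalar_prod_def lessThan_atLeast0)
  also have "\<dots> = (\<Sum>j<n. \<Sum>i<n. A $$ (i, j) * B $$ (j, i))" by (rule sum.swap)
  also have "\<dots> = mat_trace (B * A)"
    using assms by (simp add: mat_trace_def scalar_prod_def lessThan_atLeast0 mult.commute)
  finally show ?thesis .
qed

text \<open>The Schur decomposition conjugates \<open>A\<close> to a triangular matrix with diagonal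
  \<open>as\<close>, and the trace is invariant under conjugation.\<close>

lemma mat_trace_eq_sum_roots:
  fixes A :: "complex mat"
  assumes A: "A \<in> carrier_mat n n" and cp: "char_poly A = (\<Prod>a\<leftarrow>as. [:- a, 1:])"
  shows "mat_trace A = sum_list as"
proof -
  obtain B P Q where "schur_decomposition A as = (B, P, Q)" by (cases "schur_decomposition A as") auto
  from schur_decomposition[OF A cp this] have sim: "similar_mat_wit A B P Q" and diag: "diag_mat B = as" by auto
  from sim A have carr: "B \<in> carrier_mat n n" "P \<in> carrier_mat n n" "Q \<in> carrier_mat n n"
    and QP: "Q * P = 1\<^sub>m n" and eq: "A = P * B * Q"
    by (auto simp: similar_mat_wit_def Let_def)
  have "mat_trace A = mat_trace (Q * (P * B))"
    unfolding eq using carr by (intro mat_trace_mult_comm) auto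
  also have "Q * (P * B) = B" using carr QP by (simp add: assoc_mult_mat[of _ n n _ n _ n, symmetric])
  also have "mat_trace B = sum_list (diag_mat B)"
    using carr by (simp add: mat_trace_def diag_mat_def interv_sum_list_conv_sum_set_nat lessThan_atLeast0)
  finally show ?thesis by (simp add: diag)
qed


section \<open>Characters of a matrix algebra and the trace\<close>

text \<open>A commutative complex algebra \<open>'r\<close>, with scalars embedded by
  \<open>C\<close>, represented by matrices. Modulo the kernel of \<open>M\<close> it is
  finite-dimensional, and only this quotient matters. In the application \<open>M\<close> is
  multiplication on the complexified quotient ring.\<close>

locale matrix_algebra =
  fixes C :: "complex \<Rightarrow> 'r::comm_ring_1" and M :: "'r \<Rightarrow> complex mat" and k :: nat
  assumes C_hom: "comm_ring_hom C"
    and M_carrier [simp]: "M p \<in> carrier_mat k k"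
    and M_add: "M (p + q) = M p + M q"
    and M_mult: "M (p * q) = M p * M q"
    and M_C: "M (C a) = a \<cdot>\<^sub>m 1\<^sub>m k"
begin

sublocale C: comm_ring_hom C by (rule C_hom)

lemma M_dim [simp]: "dim_row (M p) = k" "dim_col (M p) = k"
  by (rule carrier_matD[OF M_carrier])+

lemma M_0: "M 0 = 0\<^sub>m k k"
  using M_C[of 0] by auto

lemma M_1: "M 1 = 1\<^sub>m k"
  using M_C[of 1] by auto

lemma M_index_add: "i < k \<Longrightarrow> j < k \<Longrightarrow> M (p + q) $$ (i, j) = M p $$ (i, j) + M q $$ (i, j)"
  by (simp add: M_add)

lemma M_index_diff: "i < k \<Longrightarrow> j < k \<Longrightarrow> M (p - q) $$ (i, j) = M p $$ (i, j) - M q $$ (i, j)"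
  using M_index_add[of i j "p - q" q] by simp

lemma M_index_sum: "i < k \<Longrightarrow> j < k \<Longrightarrow> M (sum f A) $$ (i, j) = (\<Sum>a\<in>A. M (f a) $$ (i, j))"
  by (induction A rule: infinite_finite_induct) (simp_all add: M_0 M_index_add)

lemma M_index_scale: "i < k \<Longrightarrow> j < k \<Longrightarrow> M (C a * p) $$ (i, j) = a * M p $$ (i, j)"
  by (simp add: M_mult M_C)

lemma M_eq_0_mult: "M p = 0\<^sub>m k k \<Longrightarrow> M (q * p) = 0\<^sub>m k k"
  by (simp add: M_mult)

lemma M_eq_0_add: "M p = 0\<^sub>m k k \<Longrightarrow> M q = 0\<^sub>m k k \<Longrightarrow> M (p + q) = 0\<^sub>m k k"
  by (simp add: M_add)

lemma char_matrix_M: "char_matrix (M p) a = M (p - C a)"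
  by (rule eq_matI) (auto simp: char_matrix_def M_index_diff M_C)

lemma eigenvalue_M: "eigenvalue (M p) a \<longleftrightarrow> Determinant.det (M (p - C a)) = 0"
  using eigenvalue_det[OF M_carrier] by (simp add: char_matrix_M)

lemma annihilating_product: "\<exists>as. M (\<Prod>a\<leftarrow>as. q - C a) = 0\<^sub>m k k"
proof -
  interpret poly_C: map_poly_comm_ring_hom C ..
  \<comment> \<open>The \<open>k * k + 1\<close> powers of \<open>M q\<close> up to exponent
    \<open>k * k\<close> are linearly dependent, since a matrix has only \<open>k * k\<close>
    entries. The dependency is a nonzero polynomial \<open>F\<close> annihilating \<open>q\<close>
    modulo the kernel; it splits into linear factors, and its leading coefficient is divided out at
    the end.\<close>
  have "card ({..<k} \<times> {..<k}) < card {..k * k}" by simp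
  from underdetermined_system[OF _ _ this, of "\<lambda>e u. M (q ^ u) $$ e"] obtain t where
    t: "\<exists>u\<in>{..k * k}. t u \<noteq> 0" "\<forall>e\<in>{..<k} \<times> {..<k}. (\<Sum>u\<le>k * k. M (q ^ u) $$ e * t u) = 0"
    by blast
  define F where "F = (\<Sum>u\<le>k * k. monom (t u) u)"
  have "coeff F u = t u" if "u \<le> k * k" for u
    using that by (simp add: F_def coeff_sum if_distrib cong: if_cong)
  with t(1) have "F \<noteq> 0" by force
  have "poly (map_poly C F) q = (\<Sum>u\<le>k * k. C (t u) * q ^ u)"
    by (simp add: F_def hom_distribs poly_sum poly_monom)
  then have "M (poly (map_poly C F) q) = 0\<^sub>m k k"
    using t(2) by (intro eq_matI) (auto simp: M_index_sum M_index_scale mult.commute)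
  moreover obtain as where as: "Polynomial.smult (lead_coeff F) (\<Prod>a\<leftarrow>as. [:- a, 1:]) = F"
    using fundamental_theorem_algebra_factorized[of F] by blast
  define c where "c = lead_coeff F"
  have "map_poly C (\<Prod>a\<leftarrow>as. [:- a, 1:]) = (\<Prod>a\<leftarrow>as. [:- C a, 1:])"
    by (induction as) (simp_all add: hom_distribs del: mult_pCons_left)
  then have "poly (map_poly C (\<Prod>a\<leftarrow>as. [:- a, 1:])) q = (\<Prod>a\<leftarrow>as. q - C a)"
    by (simp add: poly_prod_list o_def)
  then have "poly (map_poly C F) q = C c * (\<Prod>a\<leftarrow>as. q - C a)"
    using as[folded c_def] by (metis C.map_poly_hom_smult poly_smult)
  ultimately have "M (C c * (\<Prod>a\<leftarrow>as. q - C a)) = 0\<^sub>m k k" by simp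
  then have "M (C (inverse c) * (C c * (\<Prod>a\<leftarrow>as. q - C a))) = 0\<^sub>m k k" by (rule M_eq_0_mult)
  moreover have "C (inverse c) * C c = 1" using \<open>F \<noteq> 0\<close> by (simp add: c_def flip: C.hom_mult)
  ultimately show ?thesis by (auto simp: mult.assoc[symmetric])
qed

text \<open>The points of the spectrum of \<open>'r\<close> modulo the kernel of \<open>M\<close>;
  for a polynomial ring they become evaluations at the zeros of the ideal.\<close>

definition character :: "('r \<Rightarrow> complex) \<Rightarrow> bool" where
  "character \<chi> \<longleftrightarrow> comm_ring_hom \<chi> \<and> (\<forall>a. \<chi> (C a) = a) \<and> (\<forall>p. M p = 0\<^sub>m k k \<longrightarrow> \<chi> p = 0)"

text \<open>Suppose \<open>M q\<close> is invertible for \<open>q = p - C (\<chi> p)\<close>. Its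
  inverse is not known to be of the form \<open>M r\<close>, so \<open>q\<close> is cancelled from
  an annihilating product instead. What remains is a product of factors \<open>q - C a\<close> with
  \<open>a \<noteq> 0\<close> that still lies in the kernel; but \<open>\<chi> q = 0\<close>, so
  \<open>\<chi>\<close> maps it to a product of nonzero numbers \<open>- a\<close>.\<close>

lemma eigenvalue_character:
  assumes "character \<chi>"
  shows "eigenvalue (M p) (\<chi> p)"
proof (rule ccontr)
  interpret \<chi>: comm_ring_hom \<chi> using assms by (simp add: character_def)
  define q where "q = p - C (\<chi> p)"
  assume "\<not> ?thesis"
  then have det: "Determinant.det (M q) \<noteq> 0" by (simp add: eigenvalue_M q_def)
  have cancel: "M x = 0\<^sub>m k k" if "M (q * x) = 0\<^sub>m k k" for x
  proof (rule vec_space.det_nonzero_congruence[OF _ det])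
    show "M x * M q = 0\<^sub>m k k * M q" using that by (simp add: M_mult[symmetric] mult.commute)
  qed auto
  obtain as where as: "M (\<Prod>a\<leftarrow>as. q - C a) = 0\<^sub>m k k" using annihilating_product by blast
  \<comment> \<open>A factor with \<open>a = 0\<close> is \<open>q\<close> itself and cancels; the
    cofactor \<open>r\<close> collects the factors already passed.\<close>
  have "M (r * (\<Prod>a\<leftarrow>as. q - C a)) = 0\<^sub>m k k \<Longrightarrow>
      M (r * (\<Prod>a\<leftarrow>filter (\<lambda>a. a \<noteq> 0) as. q - C a)) = 0\<^sub>m k k" for r
  proof (induction as arbitrary: r)
    case (Cons a as)
    show ?case
    proof (cases "a = 0")
      case True
      then have "M (q * (r * (\<Prod>a\<leftarrow>as. q - C a))) = 0\<^sub>m k k" using Cons.prems by (simp add: mult_ac)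
      then show ?thesis using Cons.IH[of r] cancel True by simp
    next
      case False
      then show ?thesis using Cons.IH[of "r * (q - C a)"] Cons.prems by (simp add: mult_ac)
    qed
  qed simp
  from this[of 1] as have "\<chi> (\<Prod>a\<leftarrow>filter (\<lambda>a. a \<noteq> 0) as. q - C a) = 0"
    using assms by (simp add: character_def)
  moreover have "\<chi> (\<Prod>a\<leftarrow>bs. q - C a) = (\<Prod>a\<leftarrow>bs. - a)" for bs
    using assms by (induction bs) (simp_all add: hom_distribs q_def character_def)
  ultimately show False by (auto simp: prod_list_zero_iff)
qed

text \<open>A maximal ideal containing the kernel of \<open>M\<close> and \<open>p - C a\<close> has residue field \<open>\<complex>\<close>, because
  every element is a root of a product of linear factors modulo the kernel.\<close>

lemma character_of_eigenvalue:
  assumes "eigenvalue (M p) a"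
  shows "\<exists>\<chi>. character \<chi> \<and> \<chi> p = a"
proof -
  define q where "q = p - C a"
  \<comment> \<open>The ideal generated by \<open>q\<close> and the kernel of \<open>M\<close>. It
    is proper because otherwise \<open>M q\<close> would be invertible, against the eigenvalue
    assumption.\<close>
  define I0 where "I0 = {x. \<exists>u. M (x - u * q) = 0\<^sub>m k k}"
  define ideals where "ideals = {I. I0 \<subseteq> I \<and> (\<forall>x\<in>I. \<forall>y\<in>I. x + y \<in> I) \<and> (\<forall>x\<in>I. \<forall>r. r * x \<in> I) \<and> 1 \<notin> I}"
  have "1 \<notin> I0"
  proof
    assume "1 \<in> I0"
    then obtain u where "M (1 - u * q) = 0\<^sub>m k k" by (auto simp: I0_def)
    then have "M ((1 - u * q) + u * q) = M (u * q)" unfolding M_add by simp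
    then have "M u * M q = 1\<^sub>m k" by (simp add: M_1 M_mult)
    then have "Determinant.det (M u) * Determinant.det (M q) = 1"
      using det_mult[of "M u" k "M q"] by simp
    then show False using assms by (simp add: eigenvalue_M q_def)
  qed
  moreover have "x + y \<in> I0" if "x \<in> I0" "y \<in> I0" for x y
  proof -
    from that obtain u v where "M (x - u * q) = 0\<^sub>m k k" "M (y - v * q) = 0\<^sub>m k k" by (auto simp: I0_def)
    then have "M ((x - u * q) + (y - v * q)) = 0\<^sub>m k k" by (rule M_eq_0_add)
    then show ?thesis unfolding I0_def by (intro CollectI exI[of _ "u + v"]) (simp add: algebra_simps)
  qed
  moreover have "r * x \<in> I0" if "x \<in> I0" for x r
  proof -
    from that obtain u where "M (x - u * q) = 0\<^sub>m k k" by (auto simp: I0_def)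
    then have "M (r * (x - u * q)) = 0\<^sub>m k k" by (rule M_eq_0_mult)
    then show ?thesis unfolding I0_def by (intro CollectI exI[of _ "r * u"]) (simp add: algebra_simps)
  qed
  ultimately have "I0 \<in> ideals" by (auto simp: ideals_def)
  have "\<exists>m\<in>ideals. \<forall>X\<in>ideals. m \<subseteq> X \<longrightarrow> X = m"
  proof (rule subset_Zorn_nonempty)
    fix \<C> assume ne: "\<C> \<noteq> {}" and ch: "subset.chain ideals \<C>"
    then have sub: "\<C> \<subseteq> ideals" by (auto simp: subset_chain_def)
    have Un_add: "x + y \<in> \<Union>\<C>" if xy: "x \<in> X" "X \<in> \<C>" "y \<in> Y" "Y \<in> \<C>" for x y X Y
    proof -
      have "X \<subseteq> Y \<or> Y \<subseteq> X" using ch xy by (auto simp: subset_chain_def)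
      then obtain Z where "Z \<in> \<C>" "x \<in> Z" "y \<in> Z" using xy by blast
      moreover have "Z \<in> ideals" using sub \<open>Z \<in> \<C>\<close> by blast
      ultimately show ?thesis by (auto simp: ideals_def)
    qed
    have elem: "I0 \<subseteq> X" "1 \<notin> X" "\<And>x r. x \<in> X \<Longrightarrow> r * x \<in> X" if "X \<in> \<C>" for X
      using sub that by (auto simp: ideals_def)
    have "I0 \<subseteq> \<Union>\<C>" using elem(1) ne by blast
    moreover have "1 \<notin> \<Union>\<C>" using elem(2) by blast
    moreover have "r * x \<in> \<Union>\<C>" if "x \<in> \<Union>\<C>" for r x
    proof -
      from that obtain X where "X \<in> \<C>" "x \<in> X" by blast
      with elem(3) show ?thesis by blast
    qed
    moreover have "x + y \<in> \<Union>\<C>" if "x \<in> \<Union>\<C>" "y \<in> \<Union>\<C>" for x y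
      using that by (elim UnionE) (rule Un_add)
    ultimately show "\<Union>\<C> \<in> ideals" by (simp only: ideals_def mem_Collect_eq simp_thms ball_simps) simp
  qed (use \<open>I0 \<in> ideals\<close> in blast)
  then obtain m where m: "m \<in> ideals" and max: "\<And>X. X \<in> ideals \<Longrightarrow> m \<subseteq> X \<Longrightarrow> X = m" by blast
  have m_add: "x + y \<in> m" if "x \<in> m" "y \<in> m" for x y using m that by (auto simp: ideals_def)
  have m_mult: "r * x \<in> m" if "x \<in> m" for r x using m that by (auto simp: ideals_def)
  have m_1: "1 \<notin> m" using m by (auto simp: ideals_def)
  have m_diff: "x - y \<in> m" if "x \<in> m" "y \<in> m" for x y using m_add[OF that(1) m_mult[OF that(2), of "-1"]] by simp
  have m_ker: "x \<in> m" if "M x = 0\<^sub>m k k" for x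
  proof -
    have "x \<in> I0" using that by (auto simp: I0_def intro!: exI[of _ 0])
    then show ?thesis using m by (auto simp: ideals_def)
  qed
  have prime: "x \<in> m \<or> y \<in> m" if xy: "x * y \<in> m" for x y
  proof (rule ccontr)
    assume nin: "\<not> ?thesis"
    \<comment> \<open>The ideal generated by \<open>m\<close> and \<open>x\<close>. If it were
      proper, maximality would make it equal to \<open>m\<close>, although \<open>x\<close> is not
      in \<open>m\<close>; so it contains 1.\<close>
    define X where "X = {z. \<exists>u. z - u * x \<in> m}"
    have "m \<subseteq> X" by (auto simp: X_def intro!: exI[of _ 0])
    moreover have "x \<in> X" using m_ker[OF M_0] by (auto simp: X_def intro!: exI[of _ 1])
    ultimately have "X \<notin> ideals" using max nin by auto
    moreover have "z + w \<in> X" if "z \<in> X" "w \<in> X" for z w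
    proof -
      from that obtain u v where "z - u * x \<in> m" "w - v * x \<in> m" by (auto simp: X_def)
      from m_add[OF this] show ?thesis unfolding X_def by (intro CollectI exI[of _ "u + v"]) (simp add: algebra_simps)
    qed
    moreover have "r * z \<in> X" if "z \<in> X" for z r
    proof -
      from that obtain u where "z - u * x \<in> m" by (auto simp: X_def)
      from m_mult[OF this, of r] show ?thesis unfolding X_def by (intro CollectI exI[of _ "r * u"]) (simp add: algebra_simps)
    qed
    moreover have "I0 \<subseteq> X" using m \<open>m \<subseteq> X\<close> by (auto simp: ideals_def)
    ultimately have "1 \<in> X" unfolding ideals_def by blast
    then obtain u where "1 - u * x \<in> m" by (auto simp: X_def)
    from m_add[OF m_mult[OF this, of y] m_mult[OF xy, of u]] have "y \<in> m" by (simp add: algebra_simps)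
    then show False using nin by simp
  qed
  \<comment> \<open>A prime ideal that contains the annihilating product of \<open>z\<close>
    contains one of its linear factors; the empty product is excluded because 1 is not in
    \<open>m\<close>. So every residue class contains a constant.\<close>
  have ex: "\<exists>b. z - C b \<in> m" for z
  proof -
    obtain bs where "M (\<Prod>b\<leftarrow>bs. z - C b) = 0\<^sub>m k k" using annihilating_product by blast
    then have "(\<Prod>b\<leftarrow>bs. z - C b) \<in> m" by (rule m_ker)
    then show ?thesis
    proof (induction bs)
      case (Cons b bs)
      then have "z - C b \<in> m \<or> (\<Prod>b\<leftarrow>bs. z - C b) \<in> m" by (intro prime) simp
      then show ?case using Cons.IH by blast
    qed (use m_1 in simp)
  qed
  have uniq: "b = c" if "z - C b \<in> m" "z - C c \<in> m" for z b c
  proof (rule ccontr)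
    assume "b \<noteq> c"
    have "C (c - b) \<in> m" using m_diff[OF that] by (simp add: hom_distribs)
    from m_mult[OF this, of "C (inverse (c - b))"] have "C (inverse (c - b) * (c - b)) \<in> m"
      by (simp only: C.hom_mult)
    then show False using \<open>b \<noteq> c\<close> m_1 by simp
  qed
  define \<chi> where "\<chi> z = (THE b. z - C b \<in> m)" for z
  have \<chi>_eqI: "\<chi> z = b" if "z - C b \<in> m" for z b
    unfolding \<chi>_def using that uniq by (intro the_equality) auto
  have \<chi>: "z - C (\<chi> z) \<in> m" for z using ex[of z] \<chi>_eqI by metis
  have "comm_ring_hom \<chi>"
  proof unfold_locales
    fix x y
    show "\<chi> (x + y) = \<chi> x + \<chi> y"
      using m_add[OF \<chi>[of x] \<chi>[of y]] by (intro \<chi>_eqI) (simp add: hom_distribs algebra_simps)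
    show "\<chi> (x * y) = \<chi> x * \<chi> y"
      using m_add[OF m_mult[OF \<chi>[of y], of x] m_mult[OF \<chi>[of x], of "C (\<chi> y)"]]
      by (intro \<chi>_eqI) (simp add: hom_distribs algebra_simps)
  qed (auto intro!: \<chi>_eqI m_ker simp: M_0)
  moreover have "\<chi> (C b) = b" for b by (intro \<chi>_eqI) (simp add: m_ker M_0)
  moreover have "\<chi> x = 0" if "M x = 0\<^sub>m k k" for x using that by (intro \<chi>_eqI) (simp add: m_ker)
  moreover have "\<chi> p = a"
  proof (rule \<chi>_eqI)
    have "q \<in> I0" by (auto simp: I0_def M_0 intro!: exI[of _ 1])
    then show "p - C a \<in> m" using m by (auto simp: ideals_def q_def)
  qed
  ultimately show ?thesis by (auto simp: character_def)
qed

text \<open>Lagrange interpolation on the spectrum. Two distinct characters are different functions,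
  hence differ at some element \<open>q\<close>, and this element takes the place of a separating
  coordinate.\<close>

lemma character_interpolation:
  assumes "finite Y" "\<forall>\<chi>\<in>Y. character \<chi>"
  shows "\<exists>p. \<forall>\<chi>\<in>Y. \<chi> p = w \<chi>"
  using assms
proof (induction Y rule: finite_induct)
  case (insert \<chi>0 Y)
  from insert.IH insert.prems obtain p where p: "\<forall>\<chi>\<in>Y. \<chi> p = w \<chi>" by auto
  have "\<exists>q. \<chi> q \<noteq> \<chi>0 q" if "\<chi> \<in> Y" for \<chi>
  proof -
    have "\<chi> \<noteq> \<chi>0" using insert.hyps that by auto
    then show ?thesis by (auto simp: fun_eq_iff)
  qed
  then obtain q where q: "\<And>\<chi>. \<chi> \<in> Y \<Longrightarrow> \<chi> (q \<chi>) \<noteq> \<chi>0 (q \<chi>)" by metis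
  \<comment> \<open>Each factor vanishes at its own \<open>\<chi>\<close> and has value 1 at
    \<open>\<chi>0\<close>, so \<open>e\<close> can correct the value at \<open>\<chi>0\<close>
    without disturbing those on \<open>Y\<close>.\<close>
  define e where "e = (\<Prod>\<chi>\<in>Y. C (inverse (\<chi>0 (q \<chi>) - \<chi> (q \<chi>))) * (q \<chi> - C (\<chi> (q \<chi>))))"
  have eval: "\<psi> e = (\<Prod>\<chi>\<in>Y. inverse (\<chi>0 (q \<chi>) - \<chi> (q \<chi>)) * (\<psi> (q \<chi>) - \<chi> (q \<chi>)))"
    if "character \<psi>" for \<psi>
  proof -
    interpret \<psi>: comm_ring_hom \<psi> using that by (simp add: character_def)
    show ?thesis using that by (simp add: e_def hom_distribs character_def)
  qed
  have "\<chi>0 e = (\<Prod>\<chi>\<in>Y. inverse (\<chi>0 (q \<chi>) - \<chi> (q \<chi>)) * (\<chi>0 (q \<chi>) - \<chi> (q \<chi>)))"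
    by (rule eval) (use insert.prems in simp)
  also have "\<dots> = (\<Prod>\<chi>\<in>Y. 1)"
    by (intro prod.cong refl left_inverse) (use q in force)
  finally have "\<chi>0 e = 1" by simp
  moreover have "\<chi> e = 0" if "\<chi> \<in> Y" for \<chi> using insert.prems insert.hyps that by (subst eval) auto
  moreover have "\<psi> (p + C c * e) = \<psi> p + c * \<psi> e" if "character \<psi>" for \<psi> c
  proof -
    interpret \<psi>: comm_ring_hom \<psi> using that by (simp add: character_def)
    show ?thesis using that by (simp add: hom_distribs character_def)
  qed
  ultimately have "\<forall>\<chi>\<in>insert \<chi>0 Y. \<chi> (p + C (w \<chi>0 - \<chi>0 p) * e) = w \<chi>"
    using insert.prems p by (metis (no_types, lifting) add.commute diff_add_cancel insert_iff mult.right_neutral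
        mult_zero_right add.right_neutral)
  then show ?case by blast
qed simp

text \<open>Interpolating pairwise distinct values at \<open>k + 1\<close> characters would give a
  \<open>k\<close> by \<open>k\<close> matrix with \<open>k + 1\<close> different
  eigenvalues.\<close>

lemma finite_characters: "finite {\<chi>. character \<chi>}"
proof (rule ccontr)
  assume "infinite {\<chi>. character \<chi>}"
  then obtain Y where Y: "finite Y" "card Y = Suc k" "Y \<subseteq> {\<chi>. character \<chi>}"
    using infinite_arbitrarily_large by blast
  obtain h :: "_ \<Rightarrow> nat" where h: "inj_on h Y" using finite_imp_inj_to_nat_seg[OF Y(1)] by metis
  have "\<exists>p. \<forall>\<chi>\<in>Y. \<chi> p = of_nat (h \<chi>)"
    by (rule character_interpolation) (use Y in auto)
  then obtain p where p: "\<forall>\<chi>\<in>Y. \<chi> p = of_nat (h \<chi>)" ..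
  let ?cp = "char_poly (M p)"
  have deg: "degree ?cp = k" and "lead_coeff ?cp = 1"
    using degree_monic_char_poly[OF M_carrier, of p] by simp_all
  then have "?cp \<noteq> 0" by force
  have inj: "inj_on (\<lambda>\<chi>. \<chi> p) Y" using h p unfolding inj_on_def by (metis of_nat_eq_iff)
  have "Suc k = card ((\<lambda>\<chi>. \<chi> p) ` Y)" by (simp only: card_image[OF inj] Y(2))
  also have "\<dots> \<le> card {x. poly ?cp x = 0}"
  proof (rule card_mono[OF poly_roots_finite[OF \<open>?cp \<noteq> 0\<close>]])
    have "poly ?cp (\<chi> p) = 0" if "\<chi> \<in> Y" for \<chi>
    proof -
      have "character \<chi>" using that Y(3) by auto
      from eigenvalue_character[OF this] show ?thesis by (simp add: eigenvalue_root_char_poly[OF M_carrier])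
    qed
    then show "(\<lambda>\<chi>. \<chi> p) ` Y \<subseteq> {x. poly ?cp x = 0}" by blast
  qed
  also have "\<dots> \<le> k" using poly_roots_degree[OF \<open>?cp \<noteq> 0\<close>] deg by simp
  finally show False by simp
qed

theorem trace_eq_weighted_sum:
  "\<exists>mult :: ('r \<Rightarrow> complex) \<Rightarrow> nat. (\<forall>\<chi>. character \<chi> \<longrightarrow> mult \<chi> > 0) \<and>
     (\<forall>p. mat_trace (M p) = (\<Sum>\<chi> | character \<chi>. of_nat (mult \<chi>) * \<chi> p))"
proof -
  let ?X = "{\<chi>. character \<chi>}"
  have tr_add: "mat_trace (M (p + q)) = mat_trace (M p) + mat_trace (M q)" for p q
    by (simp add: mat_trace_def M_index_add sum.distrib)
  have tr_sum: "mat_trace (M (sum f A)) = (\<Sum>a\<in>A. mat_trace (M (f a)))" for f and A :: "('r \<Rightarrow> complex) set"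
    by (induction A rule: infinite_finite_induct) (simp_all add: M_0 tr_add, simp_all add: mat_trace_def)
  have tr_scale: "mat_trace (M (C a * p)) = a * mat_trace (M p)" for a p
    by (simp add: mat_trace_def M_index_scale sum_distrib_left)
  have spectrum: "\<exists>as. mat_trace (M p) = sum_list as \<and> set as = (\<lambda>\<chi>. \<chi> p) ` ?X" for p
  proof -
    obtain as where as: "char_poly (M p) = (\<Prod>a\<leftarrow>as. [:- a, 1:])"
      using char_poly_factorized[OF M_carrier] by blast
    have "a \<in> set as \<longleftrightarrow> eigenvalue (M p) a" for a
      using eigenvalue_root_char_poly[OF M_carrier] as by (auto simp: poly_prod_list prod_list_zero_iff)
    then have "set as = (\<lambda>\<chi>. \<chi> p) ` ?X" using eigenvalue_character character_of_eigenvalue by blast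
    then show ?thesis using mat_trace_eq_sum_roots[OF M_carrier as] by blast
  qed
  have "\<exists>p. \<forall>\<psi>\<in>?X. \<psi> p = (if \<psi> = \<chi> then 1 else 0)" for \<chi>
    by (rule character_interpolation) (simp_all add: finite_characters)
  then obtain e where e: "\<And>\<chi> \<psi>. character \<psi> \<Longrightarrow> \<psi> (e \<chi>) = (if \<psi> = \<chi> then 1 else 0)" by (metis mem_Collect_eq)
  have "\<exists>m::nat. mat_trace (M (e \<chi>)) = of_nat m \<and> (character \<chi> \<longrightarrow> m > 0)" for \<chi>
  proof -
    obtain as where as: "mat_trace (M (e \<chi>)) = sum_list as" "set as = (\<lambda>\<psi>. \<psi> (e \<chi>)) ` ?X"
      using spectrum by blast
    have "set as \<subseteq> {0, 1}" using as(2) by (auto simp: e)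
    then have "sum_list as = of_nat (count_list as 1)" by (induction as) auto
    moreover have "1 \<in> set as" if "character \<chi>"
      unfolding as(2) using that by (intro image_eqI[of _ _ \<chi>]) (simp_all add: e)
    ultimately show ?thesis using as(1) by (auto simp: count_list_0_iff intro!: gr0I)
  qed
  then obtain mult :: "('r \<Rightarrow> complex) \<Rightarrow> nat" where
    mult: "\<And>\<chi>. mat_trace (M (e \<chi>)) = of_nat (mult \<chi>)" "\<And>\<chi>. character \<chi> \<Longrightarrow> mult \<chi> > 0" by metis
  have "mat_trace (M p) = (\<Sum>\<chi>\<in>?X. of_nat (mult \<chi>) * \<chi> p)" for p
  proof -
    define s where "s = (\<Sum>\<chi>\<in>?X. C (\<chi> p) * e \<chi>)"
    have "\<psi> (p - s) = 0" if "character \<psi>" for \<psi>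
    proof -
      interpret \<psi>: comm_ring_hom \<psi> using that by (simp add: character_def)
      have "\<psi> s = (\<Sum>\<chi>\<in>?X. if \<psi> = \<chi> then \<chi> p else 0)"
        using that unfolding s_def hom_distribs by (intro sum.cong) (auto simp: e character_def)
      then show ?thesis using that finite_characters by (simp add: hom_distribs)
    qed
    moreover obtain as where "mat_trace (M (p - s)) = sum_list as" "set as = (\<lambda>\<chi>. \<chi> (p - s)) ` ?X"
      using spectrum by blast
    ultimately have "mat_trace (M (p - s)) = sum_list as" "set as \<subseteq> {0}" by auto
    moreover have "set as \<subseteq> {0} \<Longrightarrow> sum_list as = 0" for as :: "complex list" by (induction as) auto
    ultimately have "mat_trace (M p) = mat_trace (M s)" using tr_add[of "p - s" s] by simp
    also have "\<dots> = (\<Sum>\<chi>\<in>?X. \<chi> p * of_nat (mult \<chi>))"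
      by (simp only: s_def tr_sum tr_scale mult)
    finally show ?thesis by (simp only: mult.commute)
  qed
  then show ?thesis using mult(2) by blast
qed

end


section \<open>Coordinates in the quotient algebra\<close>

abbreviation coset :: "'r::comm_ring_1 set \<Rightarrow> 'r \<Rightarrow> 'r set" where
  "coset J p \<equiv> J +>\<^bsub>class_ring\<^esub> p"

lemma quotient_algebra_simps:
  fixes J :: "('v, 'k::field) mpoly set"
  shows "carrier (quotient_algebra J) = carrier (class_ring Quot J)"
    "add (quotient_algebra J) = add (class_ring Quot J)"
    "zero (quotient_algebra J) = zero (class_ring Quot J)"
    "mult (quotient_algebra J) = mult (class_ring Quot J)"
    "module.smult (quotient_algebra J) = (\<lambda>c X. coset J (Const c) \<otimes>\<^bsub>class_ring Quot J\<^esub> X)"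
  by (simp_all add: quotient_algebra_def ring.defs module.defs)

context
  fixes J :: "('v, 'k::field) mpoly set"
  assumes J: "ideal J class_ring"
begin

lemma ideal_zero: "0 \<in> J"
  using additive_subgroup.zero_closed[OF ideal.axioms(1)[OF J]] by simp

lemma ideal_add: "p \<in> J \<Longrightarrow> q \<in> J \<Longrightarrow> p + q \<in> J"
  using additive_subgroup.a_closed[OF ideal.axioms(1)[OF J]] by simp

lemma ideal_mult: "p \<in> J \<Longrightarrow> q * p \<in> J"
  using ideal.I_l_closed[OF J, of p q] by simp

lemma ideal_diff: "p \<in> J \<Longrightarrow> q \<in> J \<Longrightarrow> p - q \<in> J"
  using ideal_add[of p "- q"] ideal_mult[of q "-1"] by simp

lemma coset_hom: "coset J \<in> Ring.ring_hom class_ring (class_ring Quot J)"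
  using ideal.rcos_ring_hom[OF J] by simp

lemma coset_closed: "coset J p \<in> carrier (quotient_algebra J)"
  using ring_hom_closed[OF coset_hom, of p] by (simp add: quotient_algebra_simps)

lemma coset_add: "coset J p \<oplus>\<^bsub>quotient_algebra J\<^esub> coset J q = coset J (p + q)"
  using ring_hom_add[OF coset_hom, of p q] by (simp add: quotient_algebra_simps)

lemma coset_mult: "coset J p \<otimes>\<^bsub>quotient_algebra J\<^esub> coset J q = coset J (p * q)"
  using ring_hom_mult[OF coset_hom, of p q] by (simp add: quotient_algebra_simps)

lemma coset_smult: "c \<odot>\<^bsub>quotient_algebra J\<^esub> coset J p = coset J (Const c * p)"
  using ring_hom_mult[OF coset_hom, of "Const c" p] by (simp add: quotient_algebra_simps)

lemma coset_zero: "\<zero>\<^bsub>quotient_algebra J\<^esub> = coset J 0"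
  using ring.a_rcos_zero[OF class_ring.ring_axioms J ideal_zero]
  by (simp add: quotient_algebra_simps FactRing_def)

lemma coset_eq_iff: "coset J p = coset J q \<longleftrightarrow> p - q \<in> J"
  using ring.quotient_eq_iff_same_a_r_cos[OF class_ring.ring_axioms J, of p q]
  by (simp add: class_ring_simps)

lemma coset_surj: "X \<in> carrier (quotient_algebra J) \<Longrightarrow> \<exists>p. X = coset J p"
  by (auto simp: quotient_algebra_simps FactRing_def A_RCOSETS_def' )

interpretation V: vectorspace class_ring "quotient_algebra J"
  by (rule quotient_algebra_vectorspace[OF J])

text \<open>The bridge from the carrier-based vector space to congruences modulo \<open>J\<close>.
  Injectivity is essential because \<open>lincomb\<close> indexes coefficients by cosets, so
  coinciding cosets would be counted once.\<close>

lemma lincomb_coset: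
  assumes "finite I" "inj_on (\<lambda>i. coset J (u i)) I"
  shows "V.lincomb a ((\<lambda>i. coset J (u i)) ` I) = coset J (\<Sum>i\<in>I. Const (a (coset J (u i))) * u i)"
  using assms
proof (induction I rule: finite_induct)
  case empty
  then show ?case by (simp add: V.lincomb_def coset_zero)
next
  case (insert i I)
  let ?h = "\<lambda>i. coset J (u i)"
  have "?h i \<notin> ?h ` I" using insert.hyps insert.prems by (auto simp: inj_on_def)
  then have "V.lincomb a (?h ` insert i I) = a (?h i) \<odot>\<^bsub>quotient_algebra J\<^esub> ?h i \<oplus>\<^bsub>quotient_algebra J\<^esub> V.lincomb a (?h ` I)"
    unfolding V.lincomb_def image_insert using insert.hyps(1)
    by (intro V.M.finsum_insert) (auto simp: coset_smult coset_closed)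
  then show ?case using insert by (simp add: coset_smult coset_add)
qed

context
  fixes u :: "nat \<Rightarrow> ('v, 'k) mpoly" and n :: nat
  assumes basis: "V.basis ((\<lambda>i. coset J (u i)) ` {..<n})"
    and inj: "inj_on (\<lambda>i. coset J (u i)) {..<n}"
begin

lemma quotient_basis_span: "\<exists>c. p - (\<Sum>i<n. Const (c i) * u i) \<in> J"
proof -
  let ?B = "(\<lambda>i. coset J (u i)) ` {..<n}"
  have "coset J p \<in> V.span ?B" using basis coset_closed by (simp add: V.basis_def)
  moreover have "?B \<subseteq> carrier (quotient_algebra J)" using coset_closed by blast
  ultimately obtain a where "coset J p = V.lincomb a ?B"
    using V.finite_span[of ?B] by auto
  then have "p - (\<Sum>i<n. Const (a (coset J (u i))) * u i) \<in> J"
    using lincomb_coset[OF _ inj] by (simp add: coset_eq_iff)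
  then show ?thesis by (rule exI[of _ "\<lambda>i. a (coset J (u i))"])
qed

lemma quotient_basis_unique:
  assumes "(\<Sum>i<n. Const (c i) * u i) \<in> J" "i < n"
  shows "c i = 0"
proof -
  let ?h = "\<lambda>i. coset J (u i)"
  let ?B = "?h ` {..<n}"
  define a where "a X = c (the_inv_into {..<n} ?h X)" for X
  have a: "a (?h i) = c i" if "i < n" for i
    using that the_inv_into_f_f[OF inj, of i] by (simp add: a_def)
  have "V.lincomb a ?B = coset J (\<Sum>i<n. Const (a (?h i)) * u i)"
    by (rule lincomb_coset[OF _ inj]) simp
  also have "(\<Sum>i<n. Const (a (?h i)) * u i) = (\<Sum>i<n. Const (c i) * u i)" by (simp add: a)
  also have "coset J \<dots> = \<zero>\<^bsub>quotient_algebra J\<^esub>" using assms(1) by (simp add: coset_zero coset_eq_iff)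
  finally have "V.lincomb a ?B = \<zero>\<^bsub>quotient_algebra J\<^esub>" .
  moreover have "\<not> V.lin_dep ?B" using basis by (simp add: V.basis_def)
  ultimately have "a (?h i) = 0" using assms(2) unfolding V.lin_dep_def by fastforce
  then show ?thesis using a assms(2) by simp
qed

lemma coordinates_coset:
  assumes "p - (\<Sum>i<n. Const (c i) * u i) \<in> J" "i < n"
  shows "coordinates (quotient_algebra J) ((\<lambda>i. coset J (u i)) ` {..<n}) (coset J p) (coset J (u i)) = c i"
proof -
  let ?h = "\<lambda>i. coset J (u i)"
  let ?B = "?h ` {..<n}"
  \<comment> \<open>Outside the basis the function must be \<open>undefined\<close>, since
    \<open>coordinates\<close> selects among extensional functions.\<close>
  define a where "a = restrict (\<lambda>X. c (the_inv_into {..<n} ?h X)) ?B"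
  have a: "a (?h i) = c i" if "i < n" for i
    using that the_inv_into_f_f[OF inj, of i] by (simp add: a_def)
  have lincomb: "V.lincomb b ?B = coset J (\<Sum>i<n. Const (b (?h i)) * u i)" for b
    by (rule lincomb_coset[OF _ inj]) simp
  have "coordinates (quotient_algebra J) ?B (coset J p) = a"
    unfolding coordinates_def
  proof (rule the_equality)
    show "a \<in> ?B \<rightarrow>\<^sub>E UNIV \<and> V.lincomb a ?B = coset J p"
      using ideal_diff[OF ideal_zero assms(1)] by (simp add: lincomb a coset_eq_iff) (simp add: a_def)
  next
    fix b assume b: "b \<in> ?B \<rightarrow>\<^sub>E UNIV \<and> V.lincomb b ?B = coset J p"
    then have "(\<Sum>i<n. Const (b (?h i)) * u i) - p \<in> J" by (simp add: lincomb coset_eq_iff)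
    from ideal_add[OF this assms(1)] have "(\<Sum>i<n. Const (b (?h i) - c i) * u i) \<in> J"
      by (simp add: Const_def single_diff left_diff_distrib sum_subtractf)
    then have "b (?h i) - c i = 0" if "i < n" for i by (rule quotient_basis_unique) (rule that)
    then show "b = a" using b a by (intro PiE_ext[of b ?B _ a]) (auto simp: a_def)
  qed
  then show ?thesis by (simp add: a assms(2))
qed

end

end

text \<open>The polynomials \<open>u i\<close> represent the basis that \<^const>\<open>lin_trace\<close> chooses by \<open>SOME\<close>; working
  with that basis directly avoids the independence of the trace from the basis.\<close>

lemma lin_trace_mult_map:
  fixes J :: "('v, 'k::field) mpoly set"
  assumes J: "ideal J class_ring" and B: "finite B" "vectorspace.basis class_ring (quotient_algebra J) B"
  obtains u :: "nat \<Rightarrow> ('v, 'k) mpoly" and n where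
    "\<And>p. \<exists>c. p - (\<Sum>i<n. Const (c i) * u i) \<in> J"
    "\<And>c i. (\<Sum>i<n. Const (c i) * u i) \<in> J \<Longrightarrow> i < n \<Longrightarrow> c i = 0"
    "\<And>p c. (\<And>j. j < n \<Longrightarrow> p * u j - (\<Sum>i<n. Const (c i j) * u i) \<in> J) \<Longrightarrow>
       lin_trace (quotient_algebra J) (mult_map J p) = (\<Sum>i<n. c i i)"
proof -
  interpret V: vectorspace class_ring "quotient_algebra J" by (rule quotient_algebra_vectorspace[OF J])
  define B0 where "B0 = (SOME B. finite B \<and> V.basis B)"
  have B0: "finite B0" "V.basis B0" unfolding B0_def using someI[of "\<lambda>B. finite B \<and> V.basis B"] B by auto
  obtain X :: "nat \<Rightarrow> _" and n where X: "B0 = X ` {i. i < n}" "inj_on X {i. i < n}"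
    using finite_imp_nat_seg_image_inj_on[OF B0(1)] by blast
  have X': "B0 = X ` {..<n}" "inj_on X {..<n}" using X by (simp_all add: lessThan_def)
  have "\<exists>p. X i = coset J p" if "i < n" for i
    using B0(2) X'(1) that by (intro coset_surj[OF J]) (auto simp: V.basis_def)
  then obtain u where u: "\<And>i. i < n \<Longrightarrow> X i = coset J (u i)" by metis
  have B0_eq: "B0 = (\<lambda>i. coset J (u i)) ` {..<n}" using X'(1) u by auto
  have inj: "inj_on (\<lambda>i. coset J (u i)) {..<n}" using X'(2) u by (simp add: inj_on_def)
  have basis: "V.basis ((\<lambda>i. coset J (u i)) ` {..<n})" using B0(2) B0_eq by simp
  show ?thesis
  proof (rule that[of u n])
    show "\<exists>c. p - (\<Sum>i<n. Const (c i) * u i) \<in> J" for p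
      by (rule quotient_basis_span[OF J basis inj])
    show "c i = 0" if "(\<Sum>i<n. Const (c i) * u i) \<in> J" "i < n" for c i
      by (rule quotient_basis_unique[OF J basis inj that])
    fix p c assume c: "\<And>j. j < n \<Longrightarrow> p * u j - (\<Sum>i<n. Const (c i j) * u i) \<in> J"
    have "lin_trace (quotient_algebra J) (mult_map J p) =
        (\<Sum>b\<in>B0. coordinates (quotient_algebra J) B0 (mult_map J p b) b)"
      by (simp add: lin_trace_def B0_def Let_def)
    also have "\<dots> = (\<Sum>i<n. coordinates (quotient_algebra J) B0 (coset J (p * u i)) (coset J (u i)))"
      unfolding B0_eq by (simp add: sum.reindex[OF inj] mult_map_def coset_mult[OF J])
    also have "\<dots> = (\<Sum>i<n. c i i)"
      unfolding B0_eq by (intro sum.cong refl coordinates_coset[OF J basis inj] c) auto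
    finally show "lin_trace (quotient_algebra J) (mult_map J p) = (\<Sum>i<n. c i i)" .
  qed
qed

lemma monomial_basis_span:
  fixes J :: "('v, 'k::field) mpoly set"
  assumes J: "ideal J class_ring" and bs: "monomial_basis J bs"
  shows "\<exists>c. p - (\<Sum>i<length bs. Const (c i) * monomial (bs ! i)) \<in> J"
proof (rule quotient_basis_span[OF J])
  let ?h = "\<lambda>i. coset J (monomial (bs ! i))"
  let ?cs = "map (\<lambda>m. coset J (monomial m)) bs"
  have "set bs = (!) bs ` {..<length bs}" by (auto simp: set_conv_nth)
  then have "set ?cs = ?h ` {..<length bs}" by (simp add: image_image)
  then show "vectorspace.basis class_ring (quotient_algebra J) (?h ` {..<length bs})"
    using bs by (simp add: monomial_basis_def Let_def)
  have "distinct ?cs" using bs by (simp add: monomial_basis_def Let_def)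
  then show "inj_on ?h {..<length bs}" by (auto simp: inj_on_def distinct_conv_nth)
qed


section \<open>The trace formula\<close>

lemma poly_mapping_eq_sum_single: "p = (\<Sum>m\<in>Poly_Mapping.keys p. Poly_Mapping.single m (Poly_Mapping.lookup p m))"
  by (rule poly_mapping_eqI) (auto simp: lookup_sum lookup_single when_def in_keys_iff)

lemma poly_mapping_add_induct [case_names single add]:
  fixes P :: "('a \<Rightarrow>\<^sub>0 'b::comm_monoid_add) \<Rightarrow> bool"
  assumes "\<And>m c. P (Poly_Mapping.single m c)" "\<And>p q. P p \<Longrightarrow> P q \<Longrightarrow> P (p + q)"
  shows "P p"
proof -
  have "P (\<Sum>m\<in>A. Poly_Mapping.single m (f m))" if "finite A" for A f
    using that
  proof (induction A rule: finite_induct)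
    case empty
    then show ?case using assms(1)[of _ 0] by simp
  qed (simp add: assms)
  from this[OF finite_keys] show ?thesis by (subst poly_mapping_eq_sum_single)
qed

lemma single_eq_Const_monomial: "Poly_Mapping.single m c = Const c * monomial m"
  by (simp add: Const_def monomial_def mult_single)

lemma Const_hom: "comm_ring_hom (Const :: 'a::comm_ring_1 \<Rightarrow> ('v, 'a) mpoly)"
  by unfold_locales (simp_all add: Const_def single_add mult_single)

lemma Var_power: "Var i ^ k = monomial (Poly_Mapping.single i k)"
  by (induction k) (simp_all add: Var_def monomial_def mult_single flip: single_add)

lemma prod_monomial: "(\<Prod>i\<in>A. monomial (f i)) = monomial (sum f A)"
  by (induction A rule: infinite_finite_induct) (simp_all add: monomial_def mult_single)

lemma monomial_eq_prod_Var: "monomial m = (\<Prod>i::'v::finite\<in>UNIV. Var i ^ Poly_Mapping.lookup m i)"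
proof -
  have "m = (\<Sum>i\<in>UNIV. Poly_Mapping.single i (Poly_Mapping.lookup m i))"
    by (rule poly_mapping_eqI) (simp add: lookup_sum lookup_single when_def)
  then show ?thesis by (simp add: Var_power prod_monomial)
qed

lemma mp_eval_single:
  "\<phi> 0 = 0 \<Longrightarrow> mp_eval \<phi> z (Poly_Mapping.single m c) = \<phi> c * (\<Prod>i\<in>UNIV. z i ^ Poly_Mapping.lookup m i)"
  by (cases "c = 0") (simp_all add: mp_eval_def)

lemma mp_eval_hom:
  assumes "comm_ring_hom \<phi>"
  shows "comm_ring_hom (mp_eval \<phi> z)"
proof -
  interpret \<phi>: comm_ring_hom \<phi> by (rule assms)
  have add: "mp_eval \<phi> z (p + q) = mp_eval \<phi> z p + mp_eval \<phi> z q" for p q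
    unfolding mp_eval_def by (rule setsum_keys_plus_distrib) (simp_all add: hom_distribs distrib_right)
  show ?thesis
  proof unfold_locales
    fix p q
    show "mp_eval \<phi> z (p + q) = mp_eval \<phi> z p + mp_eval \<phi> z q" by (rule add)
    show "mp_eval \<phi> z (p * q) = mp_eval \<phi> z p * mp_eval \<phi> z q"
    proof (induction p rule: poly_mapping_add_induct)
      case (single m c)
      show ?case
        by (induction q rule: poly_mapping_add_induct)
          (simp_all add: mult_single mp_eval_single lookup_add power_add prod.distrib hom_distribs
            mult_ac distrib_left distrib_right add)
    qed (simp add: distrib_right add)
    show "mp_eval \<phi> z 1 = 1"
      using mp_eval_single[of \<phi> z 0 1] by simp
  qed (simp add: mp_eval_def)
qed

lemma mp_eval_Const: "\<phi> 0 = 0 \<Longrightarrow> mp_eval \<phi> z (Const c) = \<phi> c"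
  by (simp add: Const_def mp_eval_single)

lemma mp_eval_monomial:
  assumes "comm_ring_hom \<phi>"
  shows "mp_eval \<phi> z (monomial m) = (\<Prod>i\<in>UNIV. z i ^ Poly_Mapping.lookup m i)"
proof -
  interpret \<phi>: comm_ring_hom \<phi> by (rule assms)
  show ?thesis by (simp add: monomial_def mp_eval_single)
qed

lemma mp_eval_Var:
  assumes "comm_ring_hom \<phi>"
  shows "mp_eval \<phi> z (Var i) = z i"
proof -
  have "(\<Prod>j\<in>UNIV. z j ^ (if i = j then Suc 0 else 0)) = z i"
    by (subst prod.remove[of _ i]) auto
  then show ?thesis using assms by (simp add: Var_def mp_eval_monomial lookup_single when_def)
qed

text \<open>The universal property of the polynomial ring; it turns a character into the evaluation
  at the point whose coordinates are its values on the variables.\<close>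

lemma mpoly_hom_eq_mp_eval:
  fixes h :: "('v::finite, 'a::comm_ring_1) mpoly \<Rightarrow> 'b::comm_ring_1"
  assumes "comm_ring_hom h"
  shows "h p = mp_eval (\<lambda>c. h (Const c)) (\<lambda>i. h (Var i)) p"
proof -
  interpret h: comm_ring_hom h by (rule assms)
  have "h p = h (\<Sum>m\<in>Poly_Mapping.keys p. Const (Poly_Mapping.lookup p m) * monomial m)"
    unfolding single_eq_Const_monomial[symmetric] poly_mapping_eq_sum_single[symmetric] ..
  then show ?thesis
    by (simp add: mp_eval_def hom_distribs monomial_eq_prod_Var)
qed

lemma of_rat_hom: "comm_ring_hom (of_rat :: rat \<Rightarrow> 'a::field_char_0)"
  by unfold_locales (simp_all add: of_rat_add of_rat_mult)

lemma id_hom: "comm_ring_hom id"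
  by unfold_locales simp_all

section \<open>Multiplication matrices over the complex numbers and the zeros of the ideal\<close>

definition complexify :: "('v, rat) mpoly \<Rightarrow> ('v, complex) mpoly" where
  "complexify p = Poly_Mapping.map of_rat p"

lemma lookup_complexify: "Poly_Mapping.lookup (complexify p) m = of_rat (Poly_Mapping.lookup p m)"
  by (simp add: complexify_def Poly_Mapping.map.rep_eq when_def)

lemma keys_complexify: "Poly_Mapping.keys (complexify p) = Poly_Mapping.keys p"
  by (auto simp: in_keys_iff lookup_complexify)

lemma mp_eval_complexify: "mp_eval id z (complexify p) = mp_eval of_rat z p"
  by (simp add: mp_eval_def keys_complexify lookup_complexify)

definition zero_locus :: "('v::finite, rat) mpoly set \<Rightarrow> ('v \<Rightarrow> complex) set" where
  "zero_locus J = {z. \<forall>p\<in>J. mp_eval of_rat z p = 0}"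

locale quotient_coordinates =
  fixes J :: "('v::finite, rat) mpoly set" and u :: "nat \<Rightarrow> ('v, rat) mpoly" and n :: nat
  assumes J_ideal: "ideal J class_ring"
    and span: "\<exists>c. p - (\<Sum>i<n. Const (c i) * u i) \<in> J"
    and unique: "(\<Sum>i<n. Const (c i) * u i) \<in> J \<Longrightarrow> i < n \<Longrightarrow> c i = 0"
begin

text \<open>The coordinates modulo \<open>J\<close> in the basis \<open>u\<close>. The choice
  determines only the values at indices below \<open>n\<close>, hence the bounds in the lemmas that
  follow.\<close>

definition crd :: "('v, rat) mpoly \<Rightarrow> nat \<Rightarrow> rat" where
  "crd p = (SOME c. p - (\<Sum>i<n. Const (c i) * u i) \<in> J)"

lemma crd: "p - (\<Sum>i<n. Const (crd p i) * u i) \<in> J"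
  unfolding crd_def by (rule someI_ex[OF span])

lemma crd_eqI:
  assumes "p - (\<Sum>i<n. Const (c i) * u i) \<in> J" "i < n"
  shows "crd p i = c i"
proof -
  interpret Const: comm_ring_hom "Const :: rat \<Rightarrow> ('v, rat) mpoly" by (rule Const_hom)
  have "(\<Sum>i<n. Const (crd p i - c i) * u i) \<in> J"
    using ideal_diff[OF J_ideal assms(1) crd[of p]]
    by (simp add: hom_distribs left_diff_distrib sum_subtractf)
  then have "crd p i - c i = 0" using assms(2) by (rule unique)
  then show ?thesis by simp
qed

lemma crd_add: "i < n \<Longrightarrow> crd (p + q) i = crd p i + crd q i"
proof (rule crd_eqI)
  interpret Const: comm_ring_hom "Const :: rat \<Rightarrow> ('v, rat) mpoly" by (rule Const_hom)
  show "p + q - (\<Sum>i<n. Const (crd p i + crd q i) * u i) \<in> J"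
    using ideal_add[OF J_ideal crd[of p] crd[of q]] by (simp add: hom_distribs distrib_right sum.distrib algebra_simps)
qed

lemma crd_scale: "i < n \<Longrightarrow> crd (Const a * p) i = a * crd p i"
proof (rule crd_eqI)
  interpret Const: comm_ring_hom "Const :: rat \<Rightarrow> ('v, rat) mpoly" by (rule Const_hom)
  show "Const a * p - (\<Sum>i<n. Const (a * crd p i) * u i) \<in> J"
    using ideal_mult[OF J_ideal crd[of p], of "Const a"]
    by (simp add: hom_distribs right_diff_distrib sum_distrib_left mult.assoc)
qed

lemma crd_ideal: "p \<in> J \<Longrightarrow> i < n \<Longrightarrow> crd p i = 0"
  by (rule crd_eqI) (simp_all add: Const_def)

lemma crd_sum: "i < n \<Longrightarrow> crd (sum f A) i = (\<Sum>a\<in>A. crd (f a) i)"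
  by (induction A rule: infinite_finite_induct) (simp_all add: crd_add crd_ideal ideal_zero[OF J_ideal])

lemma crd_cong: "p - q \<in> J \<Longrightarrow> i < n \<Longrightarrow> crd p i = crd q i"
  using crd_add[of i "p - q" q] by (simp add: crd_ideal)

lemma crd_mult: "i < n \<Longrightarrow> crd (p * q) i = (\<Sum>l<n. crd q l * crd (p * u l) i)"
proof -
  assume i: "i < n"
  have "p * q - (\<Sum>l<n. Const (crd q l) * (p * u l)) \<in> J"
    using ideal_mult[OF J_ideal crd[of q], of p]
    by (simp add: right_diff_distrib sum_distrib_left mult_ac)
  from crd_cong[OF this i] show ?thesis using i by (simp add: crd_sum crd_scale)
qed

lemma mp_eval_zero_locus:
  assumes "z \<in> zero_locus J"
  shows "mp_eval of_rat z p = (\<Sum>i<n. of_rat (crd p i) * mp_eval of_rat z (u i))"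
proof -
  interpret ev: comm_ring_hom "mp_eval (of_rat :: rat \<Rightarrow> complex) z" by (rule mp_eval_hom[OF of_rat_hom])
  have "mp_eval of_rat z (p - (\<Sum>i<n. Const (crd p i) * u i)) = 0"
    using crd assms by (simp add: zero_locus_def)
  then show ?thesis by (simp add: hom_distribs mp_eval_Const)
qed

text \<open>The matrix of multiplication by \<open>P\<close> on the complexified quotient, in the
  basis \<open>u\<close>. It extends the rational matrices of the monomials linearly, so that
  \<open>J\<close> need not be extended to an ideal over the complex numbers.\<close>

definition MC :: "('v, complex) mpoly \<Rightarrow> complex mat" where
  "MC P = Matrix.mat n n (\<lambda>(i, j). \<Sum>m\<in>Poly_Mapping.keys P.
     Poly_Mapping.lookup P m * of_rat (crd (monomial m * u j) i))"

lemma MC_carrier: "MC P \<in> carrier_mat n n"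
  by (simp add: MC_def)

lemma MC_add: "MC (P + Q) = MC P + MC Q"
proof (rule eq_matI)
  fix i j assume "i < dim_row (MC P + MC Q)" "j < dim_col (MC P + MC Q)"
  then have ij: "i < n" "j < n" by (simp_all add: MC_def)
  have "(\<Sum>m\<in>Poly_Mapping.keys (P + Q). Poly_Mapping.lookup (P + Q) m * of_rat (crd (monomial m * u j) i))
    = (\<Sum>m\<in>Poly_Mapping.keys P. Poly_Mapping.lookup P m * of_rat (crd (monomial m * u j) i))
    + (\<Sum>m\<in>Poly_Mapping.keys Q. Poly_Mapping.lookup Q m * of_rat (crd (monomial m * u j) i))"
    by (rule setsum_keys_plus_distrib) (simp_all add: distrib_right)
  then show "MC (P + Q) $$ (i, j) = (MC P + MC Q) $$ (i, j)" using ij by (simp add: MC_def)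
qed (simp_all add: MC_def)

lemma MC_single: "i < n \<Longrightarrow> j < n \<Longrightarrow> MC (Poly_Mapping.single m c) $$ (i, j) = c * of_rat (crd (monomial m * u j) i)"
  by (cases "c = 0") (simp_all add: MC_def)

text \<open>Bilinearity reduces the claim to single terms, where \<open>crd_mult\<close> expresses
  that multiplying by a product is composing the multiplications.\<close>

lemma MC_mult: "MC (P * Q) = MC P * MC Q"
proof (induction P rule: poly_mapping_add_induct)
  case (single m c)
  show ?case
  proof (induction Q rule: poly_mapping_add_induct)
    case (single m' c')
    show ?case
    proof (rule eq_matI)
      fix i j
      assume "i < dim_row (MC (Poly_Mapping.single m c) * MC (Poly_Mapping.single m' c'))"
        "j < dim_col (MC (Poly_Mapping.single m c) * MC (Poly_Mapping.single m' c'))"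
      then have ij: "i < n" "j < n" by (simp_all add: MC_def)
      have "monomial (m + m') * u j = monomial m * (monomial m' * u j)"
        by (simp add: monomial_def mult_single mult.assoc[symmetric])
      then have "of_rat (crd (monomial (m + m') * u j) i) =
          (\<Sum>l<n. of_rat (crd (monomial m' * u j) l) * of_rat (crd (monomial m * u l) i) :: complex)"
        using ij by (simp add: crd_mult[of i "monomial m" "monomial m' * u j"] of_rat_sum of_rat_mult)
      moreover have "(MC (Poly_Mapping.single m c) * MC (Poly_Mapping.single m' c')) $$ (i, j)
         = (\<Sum>l<n. MC (Poly_Mapping.single m c) $$ (i, l) * MC (Poly_Mapping.single m' c') $$ (l, j))"
        using ij MC_carrier by (simp add: scalar_prod_def lessThan_atLeast0 carrier_matD[OF MC_carrier])
      ultimately show "MC (Poly_Mapping.single m c * Poly_Mapping.single m' c') $$ (i, j)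
          = (MC (Poly_Mapping.single m c) * MC (Poly_Mapping.single m' c')) $$ (i, j)"
        using ij by (simp add: mult_single MC_single) (simp add: sum_distrib_left mult_ac)
    qed (simp_all add: MC_def)
  next
    case (add p q)
    then show ?case
      by (simp add: distrib_left MC_add mult_add_distrib_mat[OF MC_carrier MC_carrier MC_carrier])
  qed
next
  case (add p q)
  then show ?case
    by (simp add: distrib_right MC_add add_mult_distrib_mat[OF MC_carrier MC_carrier MC_carrier])
qed

lemma MC_Const: "MC (Const a) = a \<cdot>\<^sub>m 1\<^sub>m n"
proof (rule eq_matI)
  fix i j assume "i < dim_row (a \<cdot>\<^sub>m 1\<^sub>m n)" "j < dim_col (a \<cdot>\<^sub>m 1\<^sub>m n)"
  then have ij: "i < n" "j < n" by simp_all
  have "crd (u j) i = (if i = j then 1 else 0)"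
  proof (rule crd_eqI)
    have "(\<Sum>i<n. Const (if i = j then 1 else 0) * u i) = (\<Sum>i<n. if i = j then u i else 0)"
      by (rule sum.cong) (auto simp: Const_def)
    then show "u j - (\<Sum>i<n. Const (if i = j then 1 else 0) * u i) \<in> J"
      using ij ideal_zero[OF J_ideal] by simp
  qed (rule ij)
  then show "MC (Const a) $$ (i, j) = (a \<cdot>\<^sub>m 1\<^sub>m n) $$ (i, j)"
    using ij by (simp add: Const_def MC_single monomial_def)
qed (simp_all add: MC_def)

sublocale matrix_algebra Const MC n
  by (intro matrix_algebra.intro Const_hom MC_carrier MC_add MC_mult MC_Const)

lemma crd_mult_eq_sum_keys:
  "i < n \<Longrightarrow> crd (p * q) i = (\<Sum>m\<in>Poly_Mapping.keys p. Poly_Mapping.lookup p m * crd (monomial m * q) i)"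
proof -
  assume i: "i < n"
  have "crd (p * q) i = crd ((\<Sum>m\<in>Poly_Mapping.keys p. Const (Poly_Mapping.lookup p m) * monomial m) * q) i"
    unfolding single_eq_Const_monomial[symmetric] poly_mapping_eq_sum_single[symmetric] ..
  then show ?thesis using i by (simp add: sum_distrib_right crd_sum crd_scale mult.assoc)
qed

lemma MC_complexify: "i < n \<Longrightarrow> j < n \<Longrightarrow> MC (complexify p) $$ (i, j) = of_rat (crd (p * u j) i)"
  by (subst crd_mult_eq_sum_keys) (simp_all add: MC_def keys_complexify lookup_complexify of_rat_sum of_rat_mult)

text \<open>The point to check is that \<open>MC P = 0\<close> forces \<open>P\<close> to vanish at
  \<open>z\<close>. Applying multiplication by \<open>P\<close> to the class of 1 and then
  evaluating the basis at \<open>z\<close> gives the value of \<open>P\<close> at \<open>z\<close>,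
  which is therefore a linear combination of the entries of \<open>MC P\<close>.\<close>

lemma character_mp_eval:
  assumes "z \<in> zero_locus J"
  shows "character (mp_eval id z)"
  unfolding character_def
proof (intro conjI allI impI)
  fix P :: "('v, complex) mpoly"
  assume MC: "MC P = 0\<^sub>m n n"
  let ?e = "\<lambda>i. mp_eval of_rat z (u i) :: complex"
  have "(\<Prod>i\<in>UNIV. z i ^ Poly_Mapping.lookup m i) =
      (\<Sum>i<n. \<Sum>j<n. of_rat (crd 1 j) * of_rat (crd (monomial m * u j) i) * ?e i)" for m
  proof -
    have "(\<Prod>i\<in>UNIV. z i ^ Poly_Mapping.lookup m i) = mp_eval of_rat z (monomial m * 1)"
      by (simp add: mp_eval_monomial[OF of_rat_hom])
    also have "\<dots> = (\<Sum>i<n. of_rat (crd (monomial m * 1) i) * ?e i)" by (rule mp_eval_zero_locus[OF assms])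
    also have "\<dots> = (\<Sum>i<n. \<Sum>j<n. of_rat (crd 1 j) * of_rat (crd (monomial m * u j) i) * ?e i)"
    proof (rule sum.cong)
      fix i assume "i \<in> {..<n}"
      then show "of_rat (crd (monomial m * 1) i) * ?e i =
          (\<Sum>j<n. of_rat (crd 1 j) * of_rat (crd (monomial m * u j) i) * ?e i)"
        by (subst crd_mult) (simp_all add: of_rat_sum of_rat_mult sum_distrib_right)
    qed simp
    finally show ?thesis .
  qed
  note monomial_z = this
  have "mp_eval id z P = (\<Sum>m\<in>Poly_Mapping.keys P.
      Poly_Mapping.lookup P m * (\<Prod>i\<in>UNIV. z i ^ Poly_Mapping.lookup m i))"
    by (simp add: mp_eval_def)
  also have "\<dots> = (\<Sum>m\<in>Poly_Mapping.keys P. \<Sum>i<n. \<Sum>j<n.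
      of_rat (crd 1 j) * ?e i * (Poly_Mapping.lookup P m * of_rat (crd (monomial m * u j) i)))"
    unfolding monomial_z by (simp add: sum_distrib_left mult_ac)
  also have "\<dots> = (\<Sum>i<n. \<Sum>m\<in>Poly_Mapping.keys P. \<Sum>j<n.
      of_rat (crd 1 j) * ?e i * (Poly_Mapping.lookup P m * of_rat (crd (monomial m * u j) i)))"
    by (rule sum.swap)
  also have "\<dots> = (\<Sum>i<n. \<Sum>j<n. \<Sum>m\<in>Poly_Mapping.keys P.
      of_rat (crd 1 j) * ?e i * (Poly_Mapping.lookup P m * of_rat (crd (monomial m * u j) i)))"
    by (intro sum.cong refl sum.swap)
  also have "\<dots> = (\<Sum>i<n. \<Sum>j<n. of_rat (crd 1 j) * ?e i * MC P $$ (i, j))"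
    by (intro sum.cong refl) (simp add: MC_def sum_distrib_left)
  also have "\<dots> = 0" by (simp add: MC)
  finally show "mp_eval id z P = 0" .
qed (simp_all add: mp_eval_hom id_hom mp_eval_Const)

text \<open>A character is the evaluation at the point \<open>z\<close> of its values on the
  variables. An element of \<open>J\<close> multiplies everything into \<open>J\<close>, so its
  matrix is zero and the character kills it; hence \<open>z\<close> is a zero of
  \<open>J\<close>.\<close>

lemma characters_eq: "{\<chi>. character \<chi>} = mp_eval id ` zero_locus J"
proof (intro equalityI subsetI)
  fix \<chi> assume "\<chi> \<in> {\<chi>. character \<chi>}"
  then have \<chi>: "comm_ring_hom \<chi>" "\<And>a. \<chi> (Const a) = a" "\<And>P. MC P = 0\<^sub>m n n \<Longrightarrow> \<chi> P = 0"
    by (auto simp: character_def)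
  define z where "z = (\<lambda>i. \<chi> (Var i))"
  have \<chi>_eq: "\<chi> P = mp_eval id z P" for P
    using mpoly_hom_eq_mp_eval[OF \<chi>(1), of P] by (simp add: \<chi>(2) z_def id_def)
  have "z \<in> zero_locus J"
    unfolding zero_locus_def
  proof (intro CollectI ballI)
    fix p assume p: "p \<in> J"
    have "MC (complexify p) = 0\<^sub>m n n"
      using ideal_mult[OF J_ideal p] MC_carrier[of "complexify p"]
      by (intro eq_matI) (auto simp: MC_complexify crd_ideal mult.commute[of p])
    then show "mp_eval of_rat z p = 0" using \<chi>(3)[of "complexify p"] by (simp add: \<chi>_eq mp_eval_complexify)
  qed
  then show "\<chi> \<in> mp_eval id ` zero_locus J" using \<chi>_eq by (intro image_eqI[of _ _ z]) auto
qed (auto simp: character_mp_eval)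

lemma inj_mp_eval: "inj_on (mp_eval id) (zero_locus J :: ('v \<Rightarrow> complex) set)"
  by (rule inj_onI) (metis ext id_hom mp_eval_Var)

lemma finite_zero_locus: "finite (zero_locus J)"
  using finite_characters unfolding characters_eq by (rule finite_imageD) (rule inj_mp_eval)

lemma zero_locus_interpolation: "\<exists>P. \<forall>z\<in>zero_locus J. mp_eval id z P = w z"
proof -
  have "\<exists>P. \<forall>\<chi>\<in>mp_eval id ` zero_locus J. \<chi> P = w (the_inv_into (zero_locus J) (mp_eval id) \<chi>)"
    by (rule character_interpolation) (simp_all add: finite_zero_locus character_mp_eval)
  then show ?thesis by (simp add: the_inv_into_f_f[OF inj_mp_eval])
qed

lemma trace_eq_sum_zero_locus:
  "\<exists>mult :: ('v \<Rightarrow> complex) \<Rightarrow> nat. (\<forall>z\<in>zero_locus J. mult z > 0) \<and>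
     (\<forall>p. of_rat (\<Sum>i<n. crd (p * u i) i) = (\<Sum>z\<in>zero_locus J. of_nat (mult z) * mp_eval of_rat z p))"
proof -
  obtain mult where mult: "\<And>\<chi>. character \<chi> \<Longrightarrow> mult \<chi> > 0"
    "\<And>P. mat_trace (MC P) = (\<Sum>\<chi> | character \<chi>. of_nat (mult \<chi>) * \<chi> P)"
    using trace_eq_weighted_sum by blast
  have "of_rat (\<Sum>i<n. crd (p * u i) i) = (\<Sum>z\<in>zero_locus J. of_nat (mult (mp_eval id z)) * mp_eval of_rat z p)" for p
  proof -
    have "of_rat (\<Sum>i<n. crd (p * u i) i) = mat_trace (MC (complexify p))"
      using MC_carrier[of "complexify p"] by (simp add: mat_trace_def MC_complexify of_rat_sum)
    also have "\<dots> = (\<Sum>z\<in>zero_locus J. of_nat (mult (mp_eval id z)) * mp_eval id z (complexify p))"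
      unfolding mult(2) characters_eq by (simp add: sum.reindex[OF inj_mp_eval])
    finally show ?thesis by (simp add: mp_eval_complexify)
  qed
  then show ?thesis using mult(1) character_mp_eval by (intro exI[of _ "\<lambda>z. mult (mp_eval id z)"]) auto
qed

end

text \<open>The right-hand side makes no reference to the basis hidden in \<open>lin_trace\<close>.
  The interpolation clause is exported along with the formula because it shows that the evaluations
  at the zeros are linearly independent.\<close>

theorem trace_formula:
  fixes J :: "('v::finite, rat) mpoly set"
  assumes J: "ideal J class_ring" and B: "finite B" "vectorspace.basis class_ring (quotient_algebra J) B"
  obtains mult :: "('v \<Rightarrow> complex) \<Rightarrow> nat" where
    "finite (zero_locus J)"
    "\<And>z. z \<in> zero_locus J \<Longrightarrow> mult z > 0"
    "\<And>p. of_rat (lin_trace (quotient_algebra J) (mult_map J p)) =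
       (\<Sum>z\<in>zero_locus J. of_nat (mult z) * mp_eval of_rat z p)"
    "\<And>w. \<exists>P. \<forall>z\<in>zero_locus J. mp_eval id z P = w z"
proof (rule lin_trace_mult_map[OF J B])
  fix u :: "nat \<Rightarrow> ('v, rat) mpoly" and n assume u:
    "\<And>p. \<exists>c. p - (\<Sum>i<n. Const (c i) * u i) \<in> J"
    "\<And>c i. (\<Sum>i<n. Const (c i) * u i) \<in> J \<Longrightarrow> i < n \<Longrightarrow> c i = 0"
    "\<And>p c. (\<And>j. j < n \<Longrightarrow> p * u j - (\<Sum>i<n. Const (c i j) * u i) \<in> J) \<Longrightarrow>
       lin_trace (quotient_algebra J) (mult_map J p) = (\<Sum>i<n. c i i)"
  interpret quotient_coordinates J u n
    by (intro quotient_coordinates.intro J u(1)) (rule u(2))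
  have "lin_trace (quotient_algebra J) (mult_map J p) = (\<Sum>i<n. crd (p * u i) i)" for p
    by (rule u(3)) (rule crd)
  moreover obtain mult :: "('v \<Rightarrow> complex) \<Rightarrow> nat" where "\<forall>z\<in>zero_locus J. mult z > 0"
    "\<forall>p. of_rat (\<Sum>i<n. crd (p * u i) i) = (\<Sum>z\<in>zero_locus J. of_nat (mult z) * mp_eval of_rat z p)"
    using trace_eq_sum_zero_locus by metis
  ultimately show ?thesis
    by (intro that[of mult] finite_zero_locus zero_locus_interpolation) simp_all
qed


section \<open>The signature of a Hermite matrix\<close>

text \<open>Pairs \<open>x\<close> and \<open>\<tau> x\<close> are removed one at a time, keeping
  \<open>x\<close>. With complex conjugation as \<open>\<tau>\<close> this selects one zero from
  each nonreal conjugate pair.\<close>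

lemma involution_transversal:
  assumes "finite T" "\<And>x. x \<in> T \<Longrightarrow> \<tau> x \<in> T \<and> \<tau> (\<tau> x) = x \<and> \<tau> x \<noteq> x"
  shows "\<exists>S. S \<inter> \<tau> ` S = {} \<and> S \<union> \<tau> ` S = T"
  using assms
proof (induction T rule: finite_psubset_induct)
  case (psubset T)
  note \<tau> = psubset.prems
  show ?case
  proof (cases "T = {}")
    case False
    then obtain x where x: "x \<in> T" by blast
    let ?T = "T - {x, \<tau> x}"
    have "\<exists>S. S \<inter> \<tau> ` S = {} \<and> S \<union> \<tau> ` S = ?T"
    proof (rule psubset.IH)
      fix y assume y: "y \<in> ?T"
      then have "\<tau> y \<noteq> x" "\<tau> y \<noteq> \<tau> x" using \<tau>[of y] \<tau>[of x] x by auto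
      then show "\<tau> y \<in> ?T \<and> \<tau> (\<tau> y) = y \<and> \<tau> y \<noteq> y" using \<tau>[of y] y by auto
    qed (use x in auto)
    then obtain S where S: "S \<inter> \<tau> ` S = {}" "S \<union> \<tau> ` S = ?T" by blast
    have "insert x S \<inter> \<tau> ` insert x S = {}" using S \<tau>[of x] x by auto
    moreover have "insert x S \<union> \<tau> ` insert x S = T" using S \<tau>[of x] x by auto
    ultimately show ?thesis by blast
  qed (intro exI[of _ "{}"], simp)
qed

section \<open>Complex conjugation on the zeros and real interpolation\<close>

definition conj_point :: "('v \<Rightarrow> complex) \<Rightarrow> 'v \<Rightarrow> complex" where
  "conj_point z = (\<lambda>i. cnj (z i))"

lemma conj_point_conj_point [simp]: "conj_point (conj_point z) = z"
  by (simp add: conj_point_def)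

lemma of_real_of_rat: "of_real (of_rat r) = (of_rat r :: complex)"
  by (cases r) (simp add: of_rat_rat)

lemma cnj_of_rat: "cnj (of_rat r) = of_rat r"
  unfolding of_real_of_rat[symmetric] by (rule complex_cnj_complex_of_real)

lemma mp_eval_of_rat_mult:
  "mp_eval (of_rat :: rat \<Rightarrow> 'a::field_char_0) z (p * q) = mp_eval of_rat z p * mp_eval of_rat z q"
proof -
  interpret comm_ring_hom "mp_eval (of_rat :: rat \<Rightarrow> 'a) z" by (rule mp_eval_hom[OF of_rat_hom])
  show ?thesis by (rule hom_mult)
qed

lemma mp_eval_conj_point: "mp_eval of_rat (conj_point z) p = cnj (mp_eval of_rat z p)"
  by (simp add: mp_eval_def conj_point_def cnj_of_rat)

lemma conj_point_zero_locus: "conj_point z \<in> zero_locus J \<longleftrightarrow> z \<in> zero_locus J"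
  by (simp add: zero_locus_def mp_eval_conj_point)

lemma sum_conj_point: "(\<Sum>z\<in>zero_locus J. F (conj_point z)) = (\<Sum>z\<in>zero_locus J. F z)"
  by (rule sum.reindex_bij_witness[of _ conj_point conj_point]) (simp_all add: conj_point_zero_locus)

lemma mp_eval_id_eq_sum:
  "mp_eval id z P = (\<Sum>m\<in>Poly_Mapping.keys P. Poly_Mapping.lookup P m * mp_eval of_rat z (monomial m))"
  by (simp only: mp_eval_monomial[OF of_rat_hom]) (simp add: mp_eval_def)

text \<open>The weighted sums in \<open>trace\<close> are rational, hence fixed by complex conjugation, and
  by interpolation they determine the weights.\<close>

lemma multiplicity_conj_point:
  fixes J :: "('v::finite, rat) mpoly set" and mult :: "('v \<Rightarrow> complex) \<Rightarrow> nat"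
  assumes fin: "finite (zero_locus J)"
    and trace: "\<And>p. of_rat (t p) = (\<Sum>z\<in>zero_locus J. of_nat (mult z) * mp_eval of_rat z p)"
    and interp: "\<And>w. \<exists>P. \<forall>z\<in>zero_locus J. mp_eval id z P = w z"
    and z0: "z0 \<in> zero_locus J"
  shows "mult (conj_point z0) = mult z0"
proof -
  define \<delta> :: "_ \<Rightarrow> complex" where "\<delta> z = of_nat (mult z) - of_nat (mult (conj_point z))" for z
  have rat: "(\<Sum>z\<in>zero_locus J. \<delta> z * mp_eval of_rat z p) = 0" for p
  proof -
    have "(\<Sum>z\<in>zero_locus J. of_nat (mult (conj_point z)) * mp_eval of_rat z p)
       = (\<Sum>z\<in>zero_locus J. cnj (of_nat (mult z) * mp_eval of_rat z p))"
      by (subst sum_conj_point[symmetric]) (simp add: mp_eval_conj_point)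
    also have "\<dots> = cnj (of_rat (t p))" by (simp only: trace cnj_sum)
    also have "\<dots> = of_rat (t p)" by (rule cnj_of_rat)
    also have "\<dots> = (\<Sum>z\<in>zero_locus J. of_nat (mult z) * mp_eval of_rat z p)" by (rule trace)
    finally show ?thesis by (simp add: \<delta>_def left_diff_distrib sum_subtractf)
  qed
  obtain P where P: "\<forall>z\<in>zero_locus J. mp_eval id z P = (if z = z0 then 1 else 0)"
    using interp[of "\<lambda>z. if z = z0 then 1 else 0"] by blast
  have "\<delta> z0 = (\<Sum>z\<in>zero_locus J. if z = z0 then \<delta> z else 0)" using fin z0 by simp
  also have "\<dots> = (\<Sum>z\<in>zero_locus J. \<delta> z * mp_eval id z P)"
    by (rule sum.cong) (use P in simp_all)
  also have "\<dots> = (\<Sum>z\<in>zero_locus J. \<Sum>m\<in>Poly_Mapping.keys P.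
      Poly_Mapping.lookup P m * (\<delta> z * mp_eval of_rat z (monomial m)))"
    unfolding mp_eval_id_eq_sum by (simp add: sum_distrib_left mult_ac)
  \<comment> \<open>\<open>rat\<close> is available for rational polynomials only, whereas
    \<open>P\<close> has complex coefficients; summing over the zeros first leaves one instance of
    \<open>rat\<close> per monomial.\<close>
  also have "\<dots> = (\<Sum>m\<in>Poly_Mapping.keys P. \<Sum>z\<in>zero_locus J.
      Poly_Mapping.lookup P m * (\<delta> z * mp_eval of_rat z (monomial m)))"
    by (rule sum.swap)
  also have "\<dots> = 0" by (simp only: sum_distrib_left[symmetric] rat mult_zero_right sum.neutral_const)
  finally show ?thesis by (simp add: \<delta>_def)
qed

text \<open>A complex interpolating polynomial \<open>P\<close> is replaced by the mean of
  \<open>P\<close> and its coefficientwise conjugate, that is, by the real parts of its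
  coefficients. Because \<open>w\<close> is compatible with conjugation, the mean still has the
  values \<open>w\<close>. Reducing its monomials modulo \<open>J\<close> gives a real combination
  of the basis monomials.\<close>

lemma real_interpolation:
  fixes J :: "('v::finite, rat) mpoly set"
  assumes J: "ideal J class_ring" and bs: "monomial_basis J bs"
    and interp: "\<And>w. \<exists>P. \<forall>z\<in>zero_locus J. mp_eval id z P = w z"
    and w: "\<And>z. z \<in> zero_locus J \<Longrightarrow> w (conj_point z) = cnj (w z)"
  shows "\<exists>v. \<forall>z\<in>zero_locus J.
    (\<Sum>i<length bs. of_real (v i) * mp_eval of_rat z (monomial (bs ! i))) = w z"
proof -
  obtain P where P: "\<And>z. z \<in> zero_locus J \<Longrightarrow> mp_eval id z P = w z" using interp[of w] by blast
  define a where "a m = (SOME c. monomial m - (\<Sum>i<length bs. Const (c i) * monomial (bs ! i)) \<in> J)" for m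
  have a: "monomial m - (\<Sum>i<length bs. Const (a m i) * monomial (bs ! i)) \<in> J" for m
    unfolding a_def by (rule someI_ex[OF monomial_basis_span[OF J bs]])
  have mono: "mp_eval of_rat z (monomial m) =
      (\<Sum>i<length bs. of_rat (a m i) * mp_eval of_rat z (monomial (bs ! i)))"
    if "z \<in> zero_locus J" for z m
  proof -
    interpret ev: comm_ring_hom "mp_eval (of_rat :: rat \<Rightarrow> complex) z" by (rule mp_eval_hom[OF of_rat_hom])
    have "mp_eval of_rat z (monomial m - (\<Sum>i<length bs. Const (a m i) * monomial (bs ! i))) = 0"
      using a that by (simp add: zero_locus_def)
    then show ?thesis by (simp add: hom_distribs mp_eval_Const)
  qed
  let ?K = "Poly_Mapping.keys P" and ?c = "Poly_Mapping.lookup P"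
  define v where "v i = (\<Sum>m\<in>?K. Re (?c m) * of_rat (a m i))" for i
  have "(\<Sum>i<length bs. of_real (v i) * mp_eval of_rat z (monomial (bs ! i))) = w z" if z: "z \<in> zero_locus J" for z
  proof -
    have "(\<Sum>i<length bs. of_real (v i) * mp_eval of_rat z (monomial (bs ! i)))
       = (\<Sum>i<length bs. \<Sum>m\<in>?K. of_real (Re (?c m)) * (of_rat (a m i) * mp_eval of_rat z (monomial (bs ! i))))"
      by (simp add: v_def sum_distrib_right mult.assoc of_real_of_rat)
    also have "\<dots> = (\<Sum>m\<in>?K. \<Sum>i<length bs. of_real (Re (?c m)) * (of_rat (a m i) * mp_eval of_rat z (monomial (bs ! i))))"
      by (rule sum.swap)
    also have "\<dots> = (\<Sum>m\<in>?K. of_real (Re (?c m)) * mp_eval of_rat z (monomial m))"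
    proof (rule sum.cong)
      show "(\<Sum>i<length bs. of_real (Re (?c m)) * (of_rat (a m i) * mp_eval of_rat z (monomial (bs ! i))))
        = of_real (Re (?c m)) * mp_eval of_rat z (monomial m)" for m
        by (subst mono[OF z, of m]) (rule sum_distrib_left[symmetric])
    qed simp
    also have "\<dots> = (\<Sum>m\<in>?K. (?c m * mp_eval of_rat z (monomial m) + cnj (?c m) * mp_eval of_rat z (monomial m)) / 2)"
      by (intro sum.cong refl) (simp add: complex_add_cnj flip: distrib_right)
    also have "\<dots> = (mp_eval id z P + cnj (mp_eval id (conj_point z) P)) / 2"
      by (simp add: mp_eval_id_eq_sum mp_eval_conj_point sum_divide_distrib[symmetric] sum.distrib)
    also have "\<dots> = w z" using P[OF z] P[of "conj_point z"] w[OF z] z by (simp add: conj_point_zero_locus)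
    finally show ?thesis .
  qed
  then show ?thesis by blast
qed

theorem hermite_matrix_signature:
  fixes J :: "('v::finite, rat) mpoly set"
  assumes J: "ideal J class_ring" and bs: "monomial_basis J bs"
  shows "finite (zero_locus J)"
    and "real_of_int (signature (map_mat real_of_rat (hermite_matrix J bs h))) =
      (\<Sum>z | z \<in> zero_locus J \<and> conj_point z = z. sgn (Re (mp_eval of_rat z h)))"
proof -
  have B: "finite (set (map (\<lambda>m. coset J (monomial m)) bs))"
    "vectorspace.basis class_ring (quotient_algebra J) (set (map (\<lambda>m. coset J (monomial m)) bs))"
    using bs by (simp_all add: monomial_basis_def Let_def)
  obtain mult :: "('v \<Rightarrow> complex) \<Rightarrow> nat" where
    fin: "finite (zero_locus J)"
    and mult: "\<And>z. z \<in> zero_locus J \<Longrightarrow> mult z > 0"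
    and trace: "\<And>p. of_rat (lin_trace (quotient_algebra J) (mult_map J p)) =
       (\<Sum>z\<in>zero_locus J. of_nat (mult z) * mp_eval of_rat z p)"
    and interp: "\<And>w. \<exists>P. \<forall>z\<in>zero_locus J. mp_eval id z P = w z"
    by (rule trace_formula[OF J B]) (rule that)
  show "finite (zero_locus J)" by (rule fin)
  let ?V = "zero_locus J" and ?k = "length bs"
  let ?e = "\<lambda>p z. mp_eval of_rat z p :: complex"
  let ?b = "\<lambda>i z. ?e (monomial (bs ! i)) z"
  note mult_conj = multiplicity_conj_point[OF fin trace interp]
  define A where "A = map_mat real_of_rat (hermite_matrix J bs h)"
  have A: "A \<in> carrier_mat ?k ?k" by (simp add: A_def hermite_matrix_def)
  have "transpose_mat A = A"
    by (rule eq_matI) (simp_all add: A_def hermite_matrix_def mult_ac)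
  have A_index: "of_real (A $$ (i, j)) = (\<Sum>z\<in>?V. of_nat (mult z) * ?e h z * ?b i z * ?b j z)"
    if "i < ?k" "j < ?k" for i j
    using that by (simp add: A_def hermite_matrix_def of_real_of_rat trace mp_eval_of_rat_mult mult.assoc)
  define R where "R = {z \<in> ?V. conj_point z = z}"
  have "finite R" using fin by (simp add: R_def)
  have "\<exists>S. S \<inter> conj_point ` S = {} \<and> S \<union> conj_point ` S = {z \<in> ?V. conj_point z \<noteq> z}"
  proof (rule involution_transversal)
    fix z assume "z \<in> {z \<in> ?V. conj_point z \<noteq> z}"
    then show "conj_point z \<in> {z \<in> ?V. conj_point z \<noteq> z} \<and> conj_point (conj_point z) = z \<and> conj_point z \<noteq> z"
      by (auto simp: conj_point_zero_locus)
  qed (simp add: fin)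
  then obtain S where S: "S \<inter> conj_point ` S = {}" "S \<union> conj_point ` S = {z \<in> ?V. conj_point z \<noteq> z}" by blast
  have SV: "S \<subseteq> ?V" and "R \<inter> S = {}" using S(2) by (auto simp: R_def)
  have "finite S" using SV fin by (rule finite_subset)
  have inj: "inj_on conj_point S" by (metis conj_point_conj_point inj_onI)
  have V_split: "(\<Sum>z\<in>?V. F z) = (\<Sum>z\<in>R. F z) + (\<Sum>z\<in>S. F z + F (conj_point z))"
    for F :: "_ \<Rightarrow> complex"
  proof -
    have "?V = R \<union> (S \<union> conj_point ` S)" unfolding S(2) by (auto simp: R_def)
    then have "(\<Sum>z\<in>?V. F z) = (\<Sum>z\<in>R \<union> (S \<union> conj_point ` S). F z)" by (rule arg_cong)
    also have "\<dots> = (\<Sum>z\<in>R. F z) + (\<Sum>z\<in>S \<union> conj_point ` S. F z)"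
      by (rule sum.union_disjoint) (use \<open>finite R\<close> fin S(2) in \<open>auto simp: R_def\<close>)
    also have "(\<Sum>z\<in>S \<union> conj_point ` S. F z) = (\<Sum>z\<in>S. F z) + (\<Sum>z\<in>conj_point ` S. F z)"
      by (rule sum.union_disjoint) (use \<open>finite S\<close> S(1) in simp_all)
    also have "(\<Sum>z\<in>conj_point ` S. F z) = (\<Sum>z\<in>S. F (conj_point z))"
      by (simp add: sum.reindex[OF inj])
    finally show ?thesis by (simp add: sum.distrib)
  qed
  \<comment> \<open>With \<open>\<beta>\<^sup>2 = 2 m h(z)\<close>, a pair of conjugate points contributes \<open>Re ((\<beta> v(z))\<^sup>2) = Re (\<beta> v(z))\<^sup>2 - Im (\<beta> v(z))\<^sup>2\<close>,
    which has signature 0.\<close>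
  define \<beta> where "\<beta> z = (if z \<in> R \<or> ?e h z = 0 then 1 else csqrt (2 * of_nat (mult z) * ?e h z))" for z
  \<comment> \<open>The value 1 at real zeros and where \<open>h\<close> vanishes keeps
    \<open>\<beta>\<close> invertible, so that arbitrary values of
    \<open>\<beta> z * val v z\<close> can be prescribed below. Where \<open>h\<close> vanishes the
    form merely gets coefficient 0.\<close>
  have \<beta>0: "\<beta> z \<noteq> 0" if "z \<in> R \<union> S" for z
    using mult[of z] that SV by (auto simp: \<beta>_def R_def)
  \<comment> \<open>One index per real linear form: \<open>False\<close> stands for the real part
    and \<open>True\<close> for the imaginary part of \<open>\<beta> z * val v z\<close>. A real
    zero has only the former.\<close>
  define I where "I = (R \<union> S) \<times> {False} \<union> S \<times> {True}"
  have finI: "finite I" using \<open>finite R\<close> \<open>finite S\<close> by (simp add: I_def)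
  have I_sum: "(\<Sum>x\<in>I. F x) = (\<Sum>z\<in>R. F (z, False)) + (\<Sum>z\<in>S. F (z, False) + F (z, True))"
    for F :: "_ \<Rightarrow> real"
  proof -
    have "(\<Sum>x\<in>I. F x) = (\<Sum>x\<in>(R \<union> S) \<times> {False}. F x) + (\<Sum>x\<in>S \<times> {True}. F x)"
      unfolding I_def using \<open>finite R\<close> \<open>finite S\<close> by (intro sum.union_disjoint) auto
    also have "\<dots> = (\<Sum>z\<in>R \<union> S. F (z, False)) + (\<Sum>z\<in>S. F (z, True))"
    proof (rule arg_cong2[of _ _ _ _ "(+)"])
      show "(\<Sum>x\<in>(R \<union> S) \<times> {False}. F x) = (\<Sum>z\<in>R \<union> S. F (z, False))"
        by (rule sum.reindex_bij_witness[of _ "\<lambda>z. (z, False)" fst]) auto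
      show "(\<Sum>x\<in>S \<times> {True}. F x) = (\<Sum>z\<in>S. F (z, True))"
        by (rule sum.reindex_bij_witness[of _ "\<lambda>z. (z, True)" fst]) auto
    qed
    also have "(\<Sum>z\<in>R \<union> S. F (z, False)) = (\<Sum>z\<in>R. F (z, False)) + (\<Sum>z\<in>S. F (z, False))"
      by (rule sum.union_disjoint) (use \<open>finite R\<close> \<open>finite S\<close> \<open>R \<inter> S = {}\<close> in simp_all)
    finally show ?thesis by (simp add: sum.distrib)
  qed
  define c where "c x = (case x of (z, t) \<Rightarrow> if z \<in> R then real (mult z) * Re (?e h z)
    else if ?e h z = 0 then 0 else if t then - 1 else 1)" for x
  define l where "l x i = (case x of (z, t) \<Rightarrow> (if t then Im else Re) (\<beta> z * ?b i z))" for x i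
  define val where "val v z = (\<Sum>i<?k. of_real (v i) * ?b i z)" for v z
  have L: "(\<Sum>i<?k. l (z, t) i * v i) = (if t then Im else Re) (\<beta> z * val v z)" for z t v
    by (simp add: l_def val_def sum_distrib_left Re_sum Im_sum algebra_simps)
  have val_conj: "val v (conj_point z) = cnj (val v z)" for v z
    by (simp add: val_def mp_eval_conj_point)
  have "real_of_int (signature A) = (\<Sum>x\<in>I. sgn (c x))"
  proof (rule signature_eq_of_square_sum[OF A \<open>transpose_mat A = A\<close> finI])
    fix v :: "nat \<Rightarrow> real"
    have double_Re: "2 * Re x = Re (2 * x)" for x by simp
    let ?F = "\<lambda>z. of_nat (mult z) * ?e h z * (val v z)\<^sup>2"
    have "of_real (\<Sum>i<?k. \<Sum>j<?k. A $$ (i, j) * v i * v j) = (\<Sum>i<?k. \<Sum>j<?k. \<Sum>z\<in>?V.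
        of_nat (mult z) * ?e h z * ?b i z * ?b j z * of_real (v i) * of_real (v j))"
      by (simp add: A_index sum_distrib_right)
    also have "\<dots> = (\<Sum>i<?k. \<Sum>z\<in>?V. \<Sum>j<?k.
        of_nat (mult z) * ?e h z * ?b i z * ?b j z * of_real (v i) * of_real (v j))"
      by (intro sum.cong refl sum.swap)
    also have "\<dots> = (\<Sum>z\<in>?V. \<Sum>i<?k. \<Sum>j<?k.
        of_nat (mult z) * ?e h z * ?b i z * ?b j z * of_real (v i) * of_real (v j))"
      by (rule sum.swap)
    also have "\<dots> = (\<Sum>z\<in>?V. ?F z)"
      by (simp add: val_def power2_eq_square sum_product sum_distrib_left mult_ac)
    also have "\<dots> = (\<Sum>z\<in>R. ?F z) + (\<Sum>z\<in>S. ?F z + ?F (conj_point z))" by (rule V_split)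
    finally have eq: "of_real (\<Sum>i<?k. \<Sum>j<?k. A $$ (i, j) * v i * v j)
        = (\<Sum>z\<in>R. ?F z) + (\<Sum>z\<in>S. ?F z + ?F (conj_point z))" .
    have "(\<Sum>i<?k. \<Sum>j<?k. A $$ (i, j) * v i * v j)
        = (\<Sum>z\<in>R. Re (?F z)) + (\<Sum>z\<in>S. Re (?F z + ?F (conj_point z)))"
      using arg_cong[OF eq, of Re] unfolding Re_complex_of_real plus_complex.sel(1) Re_sum .
    also have "\<dots> = (\<Sum>x\<in>I. c x * (\<Sum>m<?k. l x m * v m)\<^sup>2)"
      unfolding I_sum
    proof (intro arg_cong2[of _ _ _ _ "(+)"] sum.cong refl)
      fix z assume z: "z \<in> R"
      have "Im (?e h z) = 0" "Im (val v z) = 0"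
        using z mp_eval_conj_point[of z h] val_conj[of v z] by (simp_all add: R_def complex_eq_iff)
      then show "Re (?F z) = c (z, False) * (\<Sum>m<?k. l (z, False) m * v m)\<^sup>2"
        using z by (simp add: L c_def \<beta>_def power2_eq_square)
    next
      fix z assume z: "z \<in> S"
      then have "z \<in> ?V" "z \<notin> R" using SV \<open>R \<inter> S = {}\<close> by auto
      have "?F (conj_point z) = cnj (?F z)"
        by (simp only: mult_conj[OF \<open>z \<in> ?V\<close>] mp_eval_conj_point val_conj
            complex_cnj_mult complex_cnj_power complex_cnj_of_nat)
      then have "Re (?F z + ?F (conj_point z)) = 2 * Re (?F z)"
        by (simp only: plus_complex.sel cnj.sel mult_2)
      also have "\<dots> = Re (2 * ?F z)" by (simp only: double_Re)
      also have "\<dots> = Re (2 * of_nat (mult z) * ?e h z * (val v z)\<^sup>2)" by (simp only: mult.assoc)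
      also have "\<dots> = c (z, False) * (\<Sum>m<?k. l (z, False) m * v m)\<^sup>2
          + c (z, True) * (\<Sum>m<?k. l (z, True) m * v m)\<^sup>2"
      proof (cases "?e h z = 0")
        case True
        then show ?thesis using \<open>z \<notin> R\<close> by (simp add: c_def)
      next
        case False
        then have "2 * of_nat (mult z) * ?e h z * (val v z)\<^sup>2 = (\<beta> z * val v z)\<^sup>2"
          using \<open>z \<notin> R\<close> by (simp add: \<beta>_def power_mult_distrib)
        then show ?thesis using False \<open>z \<notin> R\<close> by (simp add: L c_def Re_power2)
      qed
      finally show "Re (?F z + ?F (conj_point z)) = c (z, False) * (\<Sum>m<?k. l (z, False) m * v m)\<^sup>2
          + c (z, True) * (\<Sum>m<?k. l (z, True) m * v m)\<^sup>2" .
    qed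
    finally show "(\<Sum>x\<in>I. c x * (\<Sum>m<?k. l x m * v m)\<^sup>2) = (\<Sum>i<?k. \<Sum>j<?k. A $$ (i, j) * v i * v j)" ..
  next
    fix t :: "_ \<Rightarrow> real"
    \<comment> \<open>\<open>W z\<close> is the value of \<open>v\<close> at \<open>z\<close> for
      which the real and imaginary parts of \<open>\<beta> z * val v z\<close> are the prescribed
      numbers. At the conjugate points \<open>w\<close> takes the conjugate values, as real
      interpolation requires.\<close>
    define W where "W z = Complex (t (z, False)) (t (z, True)) / \<beta> z" for z
    define w where "w z = (if z \<in> R then of_real (t (z, False)) else if z \<in> S then W z else cnj (W (conj_point z)))" for z
    have "w (conj_point z) = cnj (w z)" if zV: "z \<in> ?V" for z
    proof -
      consider "z \<in> R" | "z \<in> S" | "conj_point z \<in> S" "z \<notin> S" "z \<notin> R"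
      proof (cases "z \<in> R \<or> z \<in> S")
        case False
        then have "z \<in> S \<union> conj_point ` S" unfolding S(2) using zV by (simp add: R_def)
        then have "conj_point z \<in> S" using False by auto
        with False show thesis by (intro that(3)) simp_all
      qed (use that in blast)
      then show ?thesis
      proof cases
        case 1
        then show ?thesis by (simp add: R_def w_def)
      next
        case 2
        then have "conj_point z \<notin> S" "z \<notin> R" "conj_point z \<notin> R" using S by (auto simp: R_def)
        then show ?thesis using 2 by (simp add: w_def)
      next
        case 3
        then have "conj_point z \<notin> R" by (auto simp: R_def)
        then show ?thesis using 3 by (simp add: w_def)
      qed
    qed
    then obtain v where "\<forall>z\<in>?V. (\<Sum>i<?k. of_real (v i) * ?b i z) = w z"
      using real_interpolation[OF J bs interp, of w] by blast
    then have v: "val v z = w z" if "z \<in> ?V" for z using that by (simp add: val_def)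
    have "(\<Sum>m<?k. l (z, s) m * v m) = t (z, s)" if "(z, s) \<in> I" for z s
    proof (cases "z \<in> R")
      case True
      then show ?thesis using that \<open>R \<inter> S = {}\<close> v[of z] by (auto simp: L I_def \<beta>_def w_def R_def)
    next
      case False
      then have "z \<in> S" using that by (auto simp: I_def)
      then have "\<beta> z * val v z = Complex (t (z, False)) (t (z, True))"
        using False v[of z] SV \<beta>0[of z] by (auto simp: w_def W_def)
      then show ?thesis by (simp add: L)
    qed
    then show "\<exists>v. \<forall>x\<in>I. (\<Sum>m<?k. l x m * v m) = t x" by (intro exI[of _ v]) auto
  qed
  \<comment> \<open>The two forms of a nonreal zero have coefficients 1 and -1, or both 0, so their
    signs cancel.\<close>
  also have "\<dots> = (\<Sum>z\<in>R. sgn (c (z, False))) + (\<Sum>z\<in>S. 0)"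
    unfolding I_sum using \<open>R \<inter> S = {}\<close>
    by (intro arg_cong2[of _ _ _ _ "(+)"] sum.cong refl) (auto simp: c_def)
  also have "\<dots> = (\<Sum>z\<in>R. sgn (Re (?e h z)))"
  proof -
    have "sgn (c (z, False)) = sgn (Re (?e h z))" if "z \<in> R" for z
      using that mult[of z] by (simp add: c_def sgn_mult R_def)
    then show ?thesis by simp
  qed
  finally show "real_of_int (signature (map_mat real_of_rat (hermite_matrix J bs h))) =
      (\<Sum>z | z \<in> zero_locus J \<and> conj_point z = z. sgn (Re (mp_eval of_rat z h)))"
    by (simp only: A_def R_def)
qed


section \<open>Lagrange multipliers\<close>

lemma mp_eval_add:
  assumes "comm_ring_hom \<phi>"
  shows "mp_eval \<phi> z (p + q) = mp_eval \<phi> z p + mp_eval \<phi> z q"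
proof -
  interpret comm_ring_hom "mp_eval \<phi> z" by (rule mp_eval_hom[OF assms])
  show ?thesis by (rule hom_add)
qed

lemma pderivative_add: "pderivative i (p + q) = pderivative i p + pderivative i q"
  unfolding pderivative_def
  by (rule setsum_keys_plus_distrib) (simp_all add: distrib_left single_add)

lemma pderivative_single:
  "pderivative i (Poly_Mapping.single m c) =
     Poly_Mapping.single (m - Poly_Mapping.single i 1) (of_nat (Poly_Mapping.lookup m i) * c)"
  by (cases "c = 0") (simp_all add: pderivative_def)

lemma mp_eval_has_derivative:
  fixes x :: "real ^ 'n"
  shows "((\<lambda>x. mp_eval of_rat (vec_nth x) p) has_derivative
    (\<lambda>v. \<Sum>i\<in>UNIV. mp_eval of_rat (vec_nth x) (pderivative i p) * vec_nth v i)) (at x)"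
proof (induction p rule: poly_mapping_add_induct)
  case (single m c)
  have eq: "(\<lambda>x :: real ^ 'n. mp_eval of_rat (vec_nth x) (Poly_Mapping.single m c)) =
      (\<lambda>x. of_rat c * (\<Prod>i\<in>UNIV. vec_nth x i ^ Poly_Mapping.lookup m i))"
    by (simp add: mp_eval_single)
  have "((\<lambda>x :: real ^ 'n. of_rat c * (\<Prod>i\<in>UNIV. vec_nth x i ^ Poly_Mapping.lookup m i)) has_derivative
    (\<lambda>v. of_rat c * (\<Sum>i\<in>UNIV. of_nat (Poly_Mapping.lookup m i) * vec_nth v i *
       vec_nth x i ^ (Poly_Mapping.lookup m i - 1) * (\<Prod>j\<in>UNIV - {i}. vec_nth x j ^ Poly_Mapping.lookup m j)))) (at x)"
    by (intro has_derivative_mult_right has_derivative_prod)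
      (auto intro!: derivative_eq_intros bounded_linear_imp_has_derivative bounded_linear_vec_nth)
  moreover have "of_rat c * (\<Sum>i\<in>UNIV. of_nat (Poly_Mapping.lookup m i) * vec_nth v i *
       vec_nth x i ^ (Poly_Mapping.lookup m i - 1) * (\<Prod>j\<in>UNIV - {i}. vec_nth x j ^ Poly_Mapping.lookup m j))
     = (\<Sum>i\<in>UNIV. mp_eval of_rat (vec_nth x) (pderivative i (Poly_Mapping.single m c)) * vec_nth v i)" for v
  proof -
    have "mp_eval of_rat (vec_nth x) (pderivative i (Poly_Mapping.single m c)) =
      of_nat (Poly_Mapping.lookup m i) * of_rat c * (vec_nth x i ^ (Poly_Mapping.lookup m i - 1) *
        (\<Prod>j\<in>UNIV - {i}. vec_nth x j ^ Poly_Mapping.lookup m j))" for i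
    proof -
      have "(\<Prod>j\<in>UNIV. vec_nth x j ^ Poly_Mapping.lookup (m - Poly_Mapping.single i 1) j) =
        vec_nth x i ^ (Poly_Mapping.lookup m i - 1) * (\<Prod>j\<in>UNIV - {i}. vec_nth x j ^ Poly_Mapping.lookup m j)"
        by (subst prod.remove[of _ i]) (simp_all add: lookup_minus lookup_single when_def)
      then show ?thesis by (simp add: pderivative_single mp_eval_single of_rat_mult)
    qed
    then show ?thesis by (simp add: sum_distrib_left mult_ac)
  qed
  ultimately show ?case unfolding eq by simp
next
  case (add p q)
  then show ?case
    unfolding mp_eval_add[OF of_rat_hom] pderivative_add distrib_right sum.distrib by (rule has_derivative_add)
qed

text \<open>\<open>rows A\<close> is a set, so equal rows would be identified. The dimension first
  forces all rows to be distinct, and then a spanning set with as many elements as the dimension is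
  independent.\<close>

lemma full_rank_rows_independent:
  fixes A :: "'a::field ^ 'n ^ 'm"
  assumes "rank A = CARD('m)" and "(\<Sum>j\<in>UNIV. c j *s Finite_Cartesian_Product.row j A) = 0"
  shows "c j = 0"
proof -
  have dim: "vec.dim (Finite_Cartesian_Product.rows A) = CARD('m)" using assms(1) by (simp add: row_rank_def_gen)
  have rows: "Finite_Cartesian_Product.rows A = range (\<lambda>j. Finite_Cartesian_Product.row j A)" by (auto simp: Finite_Cartesian_Product.rows_def)
  have fin: "finite (Finite_Cartesian_Product.rows A)" by (simp add: rows)
  have "card (Finite_Cartesian_Product.rows A) \<le> CARD('m)" unfolding rows by (rule card_image_le) simp
  moreover have "vec.dim (Finite_Cartesian_Product.rows A) \<le> card (Finite_Cartesian_Product.rows A)" using fin by (rule vec.dim_le_card')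
  ultimately have card: "card (Finite_Cartesian_Product.rows A) = CARD('m)" using dim by simp
  then have inj: "inj (\<lambda>j. Finite_Cartesian_Product.row j A)" unfolding rows by (intro eq_card_imp_inj_on) simp_all
  have inv: "inv_into UNIV (\<lambda>j. Finite_Cartesian_Product.row j A) (Finite_Cartesian_Product.row j A) = j" for j
    by (rule inv_f_f[OF inj])
  have indep: "vec.independent (Finite_Cartesian_Product.rows A)"
    by (rule vec.card_le_dim_spanning[OF subset_refl vec.span_superset fin]) (simp only: card dim order_refl)
  define d where "d v = c (inv_into UNIV (\<lambda>j. Finite_Cartesian_Product.row j A) v)" for v
  have d: "d (Finite_Cartesian_Product.row j A) = c j" for j by (simp only: d_def inv)
  have sum0: "(\<Sum>v\<in>Finite_Cartesian_Product.rows A. d v *s v) = 0"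
    unfolding rows sum.reindex[OF inj] o_def d by (rule assms(2))
  have mem: "Finite_Cartesian_Product.row j A \<in> Finite_Cartesian_Product.rows A"
    unfolding rows by (rule rangeI)
  have "d (Finite_Cartesian_Product.row j A) = 0"
    by (rule vec.independentD[where u = d, OF indep fin subset_refl sum0 mem])
  then show ?thesis by (simp only: d)
qed

text \<open>If \<open>DG x\<close> were not in the span of the \<open>DF j x\<close>, then \<open>(F, G)\<close> would be open at \<open>x\<close> and \<open>G\<close> would
  take smaller values on the zero set of \<open>F\<close>.\<close>

lemma lagrange_multipliers:
  fixes F :: "'s::finite \<Rightarrow> real ^ 'n \<Rightarrow> real" and G :: "real ^ 'n \<Rightarrow> real"
    and DF :: "'s \<Rightarrow> real ^ 'n \<Rightarrow> real ^ 'n" and DG :: "real ^ 'n \<Rightarrow> real ^ 'n"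
  assumes F: "\<And>j y. (F j has_derivative (\<lambda>v. \<Sum>i\<in>UNIV. vec_nth (DF j y) i * vec_nth v i)) (at y)"
    and G: "\<And>y. (G has_derivative (\<lambda>v. \<Sum>i\<in>UNIV. vec_nth (DG y) i * vec_nth v i)) (at y)"
    and Fx: "\<And>j. F j x = 0"
    and min: "\<And>y. (\<And>j. F j y = 0) \<Longrightarrow> G x \<le> G y"
    and indep: "\<And>c. (\<Sum>j\<in>UNIV. c j *\<^sub>R DF j x) = 0 \<Longrightarrow> \<forall>j. c j = 0"
  shows "\<exists>c. DG x + (\<Sum>j\<in>UNIV. c j *\<^sub>R DF j x) = 0"
proof (rule ccontr)
  assume no: "\<not> ?thesis"
  define \<Phi> :: "real ^ 'n \<Rightarrow> real ^ 's option" where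
    "\<Phi> y = vec_lambda (\<lambda>k. case k of None \<Rightarrow> G y | Some j \<Rightarrow> F j y)" for y
  define A :: "real ^ 'n ^ 's option" where
    "A = vec_lambda (\<lambda>k. case k of None \<Rightarrow> DG x | Some j \<Rightarrow> DF j x)"
  have deriv: "(\<Phi> has_derivative (\<lambda>v. vec_lambda (\<lambda>k. case k of None \<Rightarrow> \<Sum>i\<in>UNIV. vec_nth (DG y) i * vec_nth v i
      | Some j \<Rightarrow> \<Sum>i\<in>UNIV. vec_nth (DF j y) i * vec_nth v i))) (at y)" for y
    unfolding \<Phi>_def
  proof (subst has_derivative_componentwise_within, intro ballI)
    fix b :: "real ^ 's option" assume "b \<in> Basis"
    then obtain k where b: "b = axis k 1" by (auto simp: Basis_vec_def)
    show "((\<lambda>y. inner (vec_lambda (\<lambda>k. case k of None \<Rightarrow> G y | Some j \<Rightarrow> F j y)) b) has_derivative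
        (\<lambda>v. inner (vec_lambda (\<lambda>k. case k of None \<Rightarrow> \<Sum>i\<in>UNIV. vec_nth (DG y) i * vec_nth v i
          | Some j \<Rightarrow> \<Sum>i\<in>UNIV. vec_nth (DF j y) i * vec_nth v i)) b)) (at y)"
      unfolding b inner_axis by (cases k) (simp_all add: F G)
  qed
  have A_eq: "(\<lambda>v. vec_lambda (\<lambda>k. case k of None \<Rightarrow> \<Sum>i\<in>UNIV. vec_nth (DG x) i * vec_nth v i
      | Some j \<Rightarrow> \<Sum>i\<in>UNIV. vec_nth (DF j x) i * vec_nth v i)) = (*v) A"
    by (auto simp: fun_eq_iff A_def matrix_vector_mult_def vec_eq_iff split: option.split)
  have "c k = 0" if c: "(\<Sum>k\<in>UNIV. c k *s Finite_Cartesian_Product.row k A) = 0" for c :: "'s option \<Rightarrow> real" and k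
  proof -
    have sum: "c None *\<^sub>R DG x + (\<Sum>j\<in>UNIV. c (Some j) *\<^sub>R DF j x) = 0"
      using c by (simp add: UNIV_option_conv sum.reindex Finite_Cartesian_Product.row_def A_def vec_nth_inverse scalar_mult_eq_scaleR)
    \<comment> \<open>Dividing a relation with nonzero coefficient at \<open>DG x\<close> by that
      coefficient would give the multipliers assumed not to exist.\<close>
    have c0: "c None = 0"
    proof (rule ccontr)
      assume "c None \<noteq> 0"
      then have "DG x + (\<Sum>j\<in>UNIV. (c (Some j) / c None) *\<^sub>R DF j x) = (1 / c None) *\<^sub>R
          (c None *\<^sub>R DG x + (\<Sum>j\<in>UNIV. c (Some j) *\<^sub>R DF j x))"
        by (simp add: scaleR_add_right scaleR_sum_right)
      then show False using no sum by auto
    qed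
    then have "\<forall>j. c (Some j) = 0" using sum by (intro indep) simp
    then show "c k = 0" using c0 by (cases k) auto
  qed
  then obtain B :: "real ^ 's option ^ 'n" where B: "A ** B = Finite_Cartesian_Product.mat 1"
    using matrix_right_invertible_independent_rows[of A] by auto
  \<comment> \<open>The derivative \<open>A\<close> has independent rows and hence a right inverse
    \<open>B\<close>, so the open mapping theorem applies at \<open>x\<close>.\<close>
  have "\<Phi> x \<in> interior (\<Phi> ` UNIV)"
  proof (rule sussmann_open_mapping)
    show "(\<Phi> has_derivative (*v) A) (at x)" using deriv[of x] unfolding A_eq .
    show "continuous_on UNIV \<Phi>"
      using deriv by (intro continuous_at_imp_continuous_on ballI) (rule has_derivative_continuous)
    show "bounded_linear ((*v) B)" by simp
    show "(*v) A \<circ> (*v) B = id" by (simp add: fun_eq_iff matrix_vector_mul_assoc B)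
  qed simp_all
  then obtain \<epsilon> where "\<epsilon> > 0" and ball: "ball (\<Phi> x) \<epsilon> \<subseteq> range \<Phi>" by (auto simp: mem_interior)
  \<comment> \<open>The target keeps all \<open>F j\<close> at 0 and lowers \<open>G\<close> by half
    the radius; a preimage contradicts minimality.\<close>
  define p where "p = \<Phi> x - (\<epsilon> / 2) *\<^sub>R axis None 1"
  have "dist (\<Phi> x) p < \<epsilon>" using \<open>\<epsilon> > 0\<close> by (simp add: p_def dist_norm)
  then obtain y where y: "p = \<Phi> y" using ball by (auto simp: mem_ball)
  have "vec_nth (\<Phi> y) k = vec_nth (\<Phi> x) k - (if k = None then \<epsilon> / 2 else 0)" for k
    unfolding y[symmetric] by (simp add: p_def axis_def)
  from this[of None] this[of "Some j" for j] have "G y = G x - \<epsilon> / 2" "\<And>j. F j y = 0"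
    by (simp_all add: \<Phi>_def Fx)
  then show False using min[of y] \<open>\<epsilon> > 0\<close> by simp
qed

section \<open>Zeros of the Lagrange ideal and the minimizer on the real variety\<close>

lemma kernel_ideal:
  fixes h :: "'r::comm_ring_1 \<Rightarrow> 'b::comm_ring_1"
  assumes "comm_ring_hom h"
  shows "ideal {p. h p = 0} class_ring"
proof -
  interpret h: comm_ring_hom h by (rule assms)
  have "\<ominus>\<^bsub>class_ring\<^esub> x = - x" for x :: 'r by (simp add: class_ring_simps)
  note minv = this[unfolded a_inv_def, simplified]
  show ?thesis
  proof (rule idealI)
    show "ring (class_ring :: 'r ring)" by (rule class_ring.ring_axioms)
    show "subgroup {p. h p = 0} (add_monoid (class_ring :: 'r ring))"
      by (rule subgroup.intro) (simp_all add: minv hom_distribs)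
  qed (simp_all add: hom_distribs)
qed

lemma lift_x_hom: "comm_ring_hom lift_x"
  unfolding lift_x_def[abs_def] by (rule mp_eval_hom[OF Const_hom])

lemma mp_eval_lift_x: "mp_eval of_rat \<zeta> (lift_x p) = (mp_eval of_rat (\<lambda>i. \<zeta> (Inl i)) p :: complex)"
proof -
  interpret ev: comm_ring_hom "mp_eval of_rat \<zeta> :: _ \<Rightarrow> complex" by (rule mp_eval_hom[OF of_rat_hom])
  interpret lift: comm_ring_hom lift_x by (rule lift_x_hom)
  have "comm_ring_hom (\<lambda>p. mp_eval of_rat \<zeta> (lift_x p) :: complex)"
    by unfold_locales (simp_all add: hom_distribs)
  from mpoly_hom_eq_mp_eval[OF this, of p] show ?thesis
    by (simp add: lift_x_def mp_eval_Const mp_eval_Var[OF Const_hom] mp_eval_Var[OF of_rat_hom] Const_def[of 0])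
qed

lemma lagrange_ideal_ideal: "ideal (lagrange_ideal f g) class_ring"
  unfolding lagrange_ideal_def by (rule ring.genideal_ideal[OF class_ring.ring_axioms]) simp

text \<open>The kernel of evaluation at \<open>\<zeta>\<close> is an ideal, so it contains
  \<open>lagrange_ideal f g\<close> as soon as it contains the generators.\<close>

lemma zero_locus_lagrange_ideal:
  "\<zeta> \<in> zero_locus (lagrange_ideal f g) \<longleftrightarrow>
     (\<forall>j. mp_eval of_rat (\<lambda>i. \<zeta> (Inl i)) (f j) = 0) \<and>
     (\<forall>k. mp_eval of_rat (\<lambda>i. \<zeta> (Inl i)) (pderivative k g) +
        (\<Sum>j\<in>UNIV. \<zeta> (Inr j) * mp_eval of_rat (\<lambda>i. \<zeta> (Inl i)) (pderivative k (f j))) = 0)"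
  (is "_ \<longleftrightarrow> ?R")
proof -
  interpret ev: comm_ring_hom "mp_eval of_rat \<zeta> :: _ \<Rightarrow> complex" by (rule mp_eval_hom[OF of_rat_hom])
  have "\<zeta> \<in> zero_locus (lagrange_ideal f g) \<longleftrightarrow> lagrange_ideal f g \<subseteq> {p. mp_eval of_rat \<zeta> p = 0}"
    by (auto simp: zero_locus_def)
  also have "\<dots> \<longleftrightarrow> lagrange_system f g \<subseteq> {p. mp_eval of_rat \<zeta> p = 0}"
    unfolding lagrange_ideal_def
    by (rule ring.Idl_subset_ideal[OF class_ring.ring_axioms kernel_ideal[OF ev.comm_ring_hom_axioms]]) simp
  also have "\<dots> \<longleftrightarrow> ?R"
    unfolding lagrange_system_def
    by (auto simp: hom_distribs mp_eval_lift_x mp_eval_Var[OF of_rat_hom])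
  finally show ?thesis .
qed

lemma mp_eval_of_real: "mp_eval of_rat (\<lambda>i. complex_of_real (x i)) p = of_real (mp_eval of_rat x p)"
  by (simp add: mp_eval_def of_real_of_rat)

lemma conj_point_fixed_iff: "conj_point z = z \<longleftrightarrow> (\<forall>i. z i = of_real (Re (z i)))"
  by (simp add: conj_point_def fun_eq_iff complex_eq_iff)

lemma real_points_variety:
  "x \<in> real_points (variety f) \<longleftrightarrow> (\<forall>j. mp_eval real_of_rat (vec_nth x) (f j) = 0)"
  by (simp add: real_points_def variety_def vec_lambda_inverse mp_eval_of_real)

lemma minimum_on_variety:
  fixes f :: "'s::finite \<Rightarrow> ('n::finite, rat) mpoly"
  assumes rank: "\<forall>z\<in>variety f. rank (jacobian_at f z) = CARD('s)"
    and bounded: "bounded (real_points (variety f))"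
    and x0: "x0 \<in> real_points (variety f)"
  obtains x c where "x \<in> real_points (variety f)"
    "mp_eval real_of_rat (vec_nth x) g \<le> mp_eval real_of_rat (vec_nth x0) g"
    "\<And>k. mp_eval real_of_rat (vec_nth x) (pderivative k g) +
       (\<Sum>j\<in>UNIV. c j * mp_eval real_of_rat (vec_nth x) (pderivative k (f j))) = 0"
proof -
  let ?ev = "\<lambda>p (x :: real ^ 'n). mp_eval real_of_rat (vec_nth x) p"
  have cont: "continuous_on S (?ev p)" for S p
    by (intro continuous_at_imp_continuous_on ballI) (rule has_derivative_continuous[OF mp_eval_has_derivative])
  have "real_points (variety f) = (\<Inter>j. {x. ?ev (f j) x = 0})"
    by (auto simp: real_points_variety)
  moreover have "closed {x. ?ev (f j) x = 0}" for j
    by (intro closed_Collect_eq cont continuous_on_const)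
  ultimately have "closed (real_points (variety f))" by auto
  with bounded have "compact (real_points (variety f))" by (simp add: compact_eq_bounded_closed)
  then have "\<exists>x\<in>real_points (variety f). \<forall>y\<in>real_points (variety f). ?ev g x \<le> ?ev g y"
    by (rule continuous_attains_inf) (use x0 cont in auto)
  then obtain x where x: "x \<in> real_points (variety f)"
    and min: "\<And>y. y \<in> real_points (variety f) \<Longrightarrow> ?ev g x \<le> ?ev g y"
    by blast
  define DF where "DF j y = (vec_lambda (\<lambda>k. ?ev (pderivative k (f j)) y) :: real ^ 'n)" for j y
  define DG where "DG y = (vec_lambda (\<lambda>k. ?ev (pderivative k g) y) :: real ^ 'n)" for y
  have "\<exists>c. DG x + (\<Sum>j\<in>UNIV. c j *\<^sub>R DF j x) = 0"
  proof (rule lagrange_multipliers[of "\<lambda>j. ?ev (f j)"])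
    show "(?ev (f j) has_derivative (\<lambda>v. \<Sum>i\<in>UNIV. vec_nth (DF j y) i * vec_nth v i)) (at y)" for j y
      using mp_eval_has_derivative[of "f j" y] by (simp add: DF_def)
    show "(?ev g has_derivative (\<lambda>v. \<Sum>i\<in>UNIV. vec_nth (DG y) i * vec_nth v i)) (at y)" for y
      using mp_eval_has_derivative[of g y] by (simp add: DG_def)
    show "?ev (f j) x = 0" for j using x by (simp add: real_points_variety)
    show "?ev g x \<le> ?ev g y" if "\<And>j. ?ev (f j) y = 0" for y
      using that by (intro min) (simp add: real_points_variety)
    fix c assume c: "(\<Sum>j\<in>UNIV. c j *\<^sub>R DF j x) = 0"
    \<comment> \<open>The rank hypothesis concerns the complex Jacobian. At a real point its rows
      are the real gradients, so a real relation among the gradients is a complex relation among the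
      rows.\<close>
    define z where "z = (vec_lambda (\<lambda>i. complex_of_real (vec_nth x i)) :: complex ^ 'n)"
    have z: "vec_nth z = (\<lambda>i. complex_of_real (vec_nth x i))" by (simp add: z_def fun_eq_iff)
    have "z \<in> variety f" using x by (simp add: real_points_def z_def)
    then have rank_z: "rank (jacobian_at f z) = CARD('s)" using rank by blast
    have "(\<Sum>j\<in>UNIV. complex_of_real (c j) *s Finite_Cartesian_Product.row j (jacobian_at f z)) = 0"
    proof (rule Finite_Cartesian_Product.vec_eq_iff[THEN iffD2], rule allI)
      fix i
      have "(\<Sum>j\<in>UNIV. c j * ?ev (pderivative i (f j)) x) = vec_nth (\<Sum>j\<in>UNIV. c j *\<^sub>R DF j x) i"
        by (simp add: DF_def)
      then have "(\<Sum>j\<in>UNIV. c j * ?ev (pderivative i (f j)) x) = 0" by (simp add: c)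
      then have "(\<Sum>j\<in>UNIV. complex_of_real (c j) * of_real (?ev (pderivative i (f j)) x)) = 0"
        by (simp only: of_real_sum[symmetric] of_real_mult[symmetric] of_real_0)
      then show "vec_nth (\<Sum>j\<in>UNIV. complex_of_real (c j) *s Finite_Cartesian_Product.row j (jacobian_at f z)) i = vec_nth 0 i"
        by (simp add: Finite_Cartesian_Product.row_def jacobian_at_def z mp_eval_of_real)
    qed
    then have "complex_of_real (c j) = 0" for j by (rule full_rank_rows_independent[OF rank_z])
    then show "\<forall>j. c j = 0" by simp
  qed
  then obtain c where c: "DG x + (\<Sum>j\<in>UNIV. c j *\<^sub>R DF j x) = 0" by blast
  have "?ev (pderivative k g) x + (\<Sum>j\<in>UNIV. c j * ?ev (pderivative k (f j)) x) = 0" for k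
  proof -
    have "?ev (pderivative k g) x + (\<Sum>j\<in>UNIV. c j * ?ev (pderivative k (f j)) x)
      = vec_nth (DG x + (\<Sum>j\<in>UNIV. c j *\<^sub>R DF j x)) k" by (simp add: DG_def DF_def)
    then show ?thesis by (simp add: c)
  qed
  then show ?thesis using that x min[OF x0] by blast
qed

theorem theorem6p5:
  fixes f :: "'s::finite \<Rightarrow> ('n::finite, rat) mpoly"
    and g :: "('n, rat) mpoly"
    and \<B> :: "('n + 's \<Rightarrow>\<^sub>0 nat) list"
  assumes "\<forall>z\<in>variety f. rank (jacobian_at f z) = CARD('s) \<and> CARD('s) \<le> CARD('n)"
    and "bounded (real_points (variety f))"
    and "finite {z. critical_point f g z}"
    and "monomial_basis (lagrange_ideal f g) \<B>"
  shows "signature (map_mat real_of_rat (hermite_matrix (lagrange_ideal f g) \<B> (lift_x g))) =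
         signature (map_mat real_of_rat (hermite_matrix (lagrange_ideal f g) \<B> (lift_x (g\<^sup>2))))
         \<longleftrightarrow> (\<forall>x\<in>real_points (variety f). mp_eval real_of_rat (vec_nth x) g \<ge> 0)"
  (is "?sig1 = ?sig2 \<longleftrightarrow> ?nonneg")
proof -
  let ?J = "lagrange_ideal f g"
  let ?gx = "\<lambda>x :: real ^ 'n. mp_eval real_of_rat (vec_nth x) g"
  define R where "R = {z. z \<in> zero_locus ?J \<and> conj_point z = z}"
  define x where "x z = (vec_lambda (\<lambda>i. Re (z (Inl i))) :: real ^ 'n)" for z :: "'n + 's \<Rightarrow> complex"
  note sig = hermite_matrix_signature[OF lagrange_ideal_ideal assms(4)]
  have "finite R" using sig(1) by (simp add: R_def)
  have eval_R: "mp_eval of_rat (\<lambda>i. z (Inl i)) p = complex_of_real (mp_eval of_rat (vec_nth (x z)) p)"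
    if "z \<in> R" for z p
  proof -
    have "(\<lambda>i. z (Inl i)) = (\<lambda>i. complex_of_real (vec_nth (x z) i))"
      using that unfolding R_def conj_point_fixed_iff by (auto simp: x_def)
    then show ?thesis by (simp only: mp_eval_of_real)
  qed
  have sig1: "real_of_int ?sig1 = (\<Sum>z\<in>R. sgn (?gx (x z)))"
    using sig(2)[of "lift_x g"] by (simp add: R_def[symmetric] mp_eval_lift_x eval_R)
  have sig2: "real_of_int ?sig2 = (\<Sum>z\<in>R. sgn ((?gx (x z))\<^sup>2))"
    using sig(2)[of "lift_x (g\<^sup>2)"]
    by (simp add: R_def[symmetric] mp_eval_lift_x eval_R power2_eq_square mp_eval_of_rat_mult)
  have x_R: "x z \<in> real_points (variety f)" if "z \<in> R" for z
    using that eval_R[OF that] unfolding R_def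
    by (auto simp: zero_locus_lagrange_ideal real_points_variety)
  \<comment> \<open>The first inequality makes every term of the difference of the two signatures
    nonnegative, so the difference vanishes exactly if every term does; the second fact then says
    that \<open>g\<close> is nonnegative at every real zero.\<close>
  have sgn_le: "sgn a \<le> sgn (a\<^sup>2)" and sgn_eq: "sgn (a\<^sup>2) - sgn a = 0 \<longleftrightarrow> a \<ge> 0" for a :: real
    by (auto simp: sgn_if)
  have "?sig1 = ?sig2 \<longleftrightarrow> (\<Sum>z\<in>R. sgn ((?gx (x z))\<^sup>2) - sgn (?gx (x z))) = 0"
    unfolding sum_subtractf sig1[symmetric] sig2[symmetric] by auto
  also have "\<dots> \<longleftrightarrow> (\<forall>z\<in>R. sgn ((?gx (x z))\<^sup>2) - sgn (?gx (x z)) = 0)"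
    by (rule sum_nonneg_eq_0_iff[OF \<open>finite R\<close>]) (simp only: diff_ge_0_iff_ge sgn_le)
  also have "\<dots> \<longleftrightarrow> (\<forall>z\<in>R. ?gx (x z) \<ge> 0)"
    by (simp only: sgn_eq)
  also have "\<dots> \<longleftrightarrow> ?nonneg"
  proof
    assume nonneg: "\<forall>z\<in>R. ?gx (x z) \<ge> 0"
    show ?nonneg
    proof
      fix x0 assume "x0 \<in> real_points (variety f)"
      then obtain y c where y: "y \<in> real_points (variety f)" "?gx y \<le> ?gx x0"
        "\<And>k. mp_eval real_of_rat (vec_nth y) (pderivative k g) +
           (\<Sum>j\<in>UNIV. c j * mp_eval real_of_rat (vec_nth y) (pderivative k (f j))) = 0"
        using minimum_on_variety[of f x0 g] assms(1,2) by blast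
      \<comment> \<open>The minimizer \<open>y\<close> supplies the coordinates \<open>x\<close> and
        its multipliers \<open>c\<close> the coordinates for the Lagrange variables; all are real,
        so \<open>z\<close> is fixed by conjugation.\<close>
      define z where "z = (\<lambda>v. complex_of_real (case v of Inl i \<Rightarrow> vec_nth y i | Inr j \<Rightarrow> c j))"
      have "z \<in> zero_locus ?J"
        unfolding zero_locus_lagrange_ideal
      proof (intro conjI allI)
        show "mp_eval of_rat (\<lambda>i. z (Inl i)) (f j) = 0" for j
          using y(1) by (simp add: z_def mp_eval_of_real real_points_variety)
        show "mp_eval of_rat (\<lambda>i. z (Inl i)) (pderivative k g) +
          (\<Sum>j\<in>UNIV. z (Inr j) * mp_eval of_rat (\<lambda>i. z (Inl i)) (pderivative k (f j))) = 0" for k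
          using arg_cong[OF y(3)[of k], of complex_of_real] by (simp add: z_def mp_eval_of_real)
      qed
      then have "z \<in> R" by (simp add: R_def z_def conj_point_def)
      moreover have "x z = y" by (simp add: x_def z_def Finite_Cartesian_Product.vec_eq_iff)
      ultimately have "?gx y \<ge> 0" using nonneg by blast
      then show "?gx x0 \<ge> 0" using y(2) by simp
    qed
  qed (use x_R in blast)
  finally show ?thesis .
qed

end
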